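(* Let $1<p<\infty$, $\alpha>0$, $\beta_{p\text{-}hom}>0$, and let $f\in L^2(\Omega)$ be not a constant function. A pair $(w^*,u^* )\in L^p(\Omega)\times \mathrm{BV}(\Omega)$ is a solution of $$\min_{u\in \mathrm{BV}(\Omega),\ w\in L^p(\Omega)}\ \frac12\|f-u\|_{L^2(\Omega)}^2+\alpha\|Du-w\|_{\mathcal M}+\frac{\beta_{p\text{-}hom}}{p}\|w\|_{L^p(\Omega)}^p$$ if and only if it is a solution of $$\min_{u\in \mathrm{BV}(\Omega),\ w\in L^p(\Omega)}\ \frac12\|f-u\|_{L^2(\Omega)}^2+\alpha\|Du-w\|_{\mathcal M}+\beta_{1\text{-}hom}\|w\|_{L^p(\Omega)},$$ where $\beta_{1\text{-}hom}=\beta_{p\text{-}hom}\|w^*\|_{L^p(\Omega)}^{p-1}$.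
   Context: $\Omega\subset\mathbb{R}^d$ is a bounded domain (open and connected) with Lipschitz boundary. $w\in L^p(\Omega)$ is $\mathbb{R}^d$-valued, $\|w\|_{L^p(\Omega)}$ is the $L^p$ norm of the pointwise Euclidean norm, $Du$ is the distributional derivative of $u$ (a finite Radon measure for $u\in\mathrm{BV}(\Omega)$), $w$ is identified with the measure $w\,\mathcal L^d$, and $\|\mu\|_{\mathcal M}=|\mu|(\Omega)$ is the Radon (total variation) norm. The term $\|f-u\|_{L^2(\Omega)}^2$ is $+\infty$ if $u\notin L^2(\Omega)$. A solution is a minimising pair. *)

theory Defs
  imports "HOL-Analysis.Analysis"
begin

text \<open>A boundary point has a neighbourhood in which the set is the strict epigraph, in a unit
  direction \<open>e\<close>, of a Lipschitz function of the component orthogonal to \<open>e\<close>. For bounded sets,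
  compactness of the boundary makes the number of charts finite.\<close>

definition lipschitz_boundary :: "'a::euclidean_space set \<Rightarrow> bool" where
  "lipschitz_boundary \<Omega> \<longleftrightarrow>
     (\<forall>x\<in>frontier \<Omega>. \<exists>r>0. \<exists>e. norm e = 1 \<and>
        (\<exists>g :: 'a \<Rightarrow> real. \<exists>L. L-lipschitz_on {z. z \<bullet> e = 0} g \<and>
           \<Omega> \<inter> ball x r = {y \<in> ball x r. g (y - (y \<bullet> e) *\<^sub>R e) < y \<bullet> e}))"

definition bounded_lipschitz_domain :: "'a::euclidean_space set \<Rightarrow> bool" where
  "bounded_lipschitz_domain \<Omega> \<longleftrightarrow>
     open \<Omega> \<and> connected \<Omega> \<and> bounded \<Omega> \<and> lipschitz_boundary \<Omega>"

text \<open>Lebesgue spaces are sets of representatives: functions on the whole space of which only the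
  restriction to \<open>\<Omega>\<close> matters.\<close>

definition Lp :: "real \<Rightarrow> 'a::euclidean_space set \<Rightarrow> ('a \<Rightarrow> 'b::euclidean_space) set" where
  "Lp p \<Omega> = {g \<in> borel_measurable (lebesgue_on \<Omega>).
               integrable (lebesgue_on \<Omega>) (\<lambda>x. norm (g x) powr p)}"

definition Lp_norm :: "real \<Rightarrow> 'a::euclidean_space set \<Rightarrow> ('a \<Rightarrow> 'b::euclidean_space) \<Rightarrow> real" where
  "Lp_norm p \<Omega> g = (\<integral>x. norm (g x) powr p \<partial>lebesgue_on \<Omega>) powr (1 / p)"

text \<open>Vector measures are set functions on the \<open>\<sigma>\<close>-algebra of a measure space \<open>M\<close>; the measure
  of \<open>M\<close> itself plays no role, and values outside \<open>sets M\<close> are irrelevant.\<close>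

definition variation ::
    "'a measure \<Rightarrow> ('a set \<Rightarrow> 'b::real_normed_vector) \<Rightarrow> 'a set \<Rightarrow> ennreal" where
  "variation M \<mu> A =
     (SUP B\<in>{B :: nat \<Rightarrow> 'a set. range B \<subseteq> sets M \<and> disjoint_family B \<and> (\<Union>n. B n) = A}.
        \<Sum>n. ennreal (norm (\<mu> (B n))))"

definition finite_vector_measure ::
    "'a measure \<Rightarrow> ('a set \<Rightarrow> 'b::real_normed_vector) \<Rightarrow> bool" where
  "finite_vector_measure M \<mu> \<longleftrightarrow>
     (\<forall>A :: nat \<Rightarrow> 'a set. range A \<subseteq> sets M \<longrightarrow> disjoint_family A \<longrightarrow>
        (\<lambda>n. \<mu> (A n)) sums \<mu> (\<Union>n. A n)) \<and>
     variation M \<mu> (space M) < \<infinity>"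

text \<open>The positive part \<open>\<nu>\<^sup>+\<close> of the Jordan decomposition \<open>\<nu> = \<nu>\<^sup>+ - \<nu>\<^sup>-\<close>; the negative part is
  the positive part of \<open>-\<nu>\<close>.\<close>

definition positive_part :: "'a measure \<Rightarrow> ('a set \<Rightarrow> real) \<Rightarrow> 'a measure" where
  "positive_part M \<nu> =
     measure_of (space M) (sets M) (\<lambda>A. SUP B\<in>{B \<in> sets M. B \<subseteq> A}. ennreal (\<nu> B))"

definition signed_integral :: "'a measure \<Rightarrow> ('a set \<Rightarrow> real) \<Rightarrow> ('a \<Rightarrow> real) \<Rightarrow> real" where
  "signed_integral M \<nu> \<phi> =
     (\<integral>x. \<phi> x \<partial>positive_part M \<nu>) - (\<integral>x. \<phi> x \<partial>positive_part M (\<lambda>A. - \<nu> A))"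

text \<open>On an open subset of Euclidean space every finite Borel vector measure is a Radon measure.\<close>

abbreviation finite_radon_measure ::
    "'a::euclidean_space set \<Rightarrow> ('a set \<Rightarrow> 'b::real_normed_vector) \<Rightarrow> bool" where
  "finite_radon_measure \<Omega> \<equiv> finite_vector_measure (restrict_space borel \<Omega>)"

definition radon_norm ::
    "'a::euclidean_space set \<Rightarrow> ('a set \<Rightarrow> 'b::real_normed_vector) \<Rightarrow> ennreal" where
  "radon_norm \<Omega> \<mu> = variation (restrict_space borel \<Omega>) \<mu> \<Omega>"

definition density_measure ::
    "'a::euclidean_space set \<Rightarrow> ('a \<Rightarrow> 'b::euclidean_space) \<Rightarrow> 'a set \<Rightarrow> 'b" where
  "density_measure \<Omega> w A = (\<integral>x. indicator A x *\<^sub>R w x \<partial>lebesgue_on \<Omega>)"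

definition partial_derivative :: "'d \<Rightarrow> (real^'d \<Rightarrow> real) \<Rightarrow> real^'d \<Rightarrow> real" where
  "partial_derivative i \<phi> x = frechet_derivative \<phi> (at x) (axis i 1)"

primrec k_times_cont_diff :: "nat \<Rightarrow> (real^'d \<Rightarrow> real) \<Rightarrow> bool" where
  "k_times_cont_diff 0 \<phi> \<longleftrightarrow> continuous_on UNIV \<phi>"
| "k_times_cont_diff (Suc k) \<phi> \<longleftrightarrow>
     \<phi> differentiable_on UNIV \<and> (\<forall>i. k_times_cont_diff k (partial_derivative i \<phi>))"

definition test_functions :: "(real^'d) set \<Rightarrow> (real^'d \<Rightarrow> real) set" where
  "test_functions \<Omega> =
     {\<phi>. (\<forall>k. k_times_cont_diff k \<phi>) \<and>
         compact (closure {x. \<phi> x \<noteq> 0}) \<and> closure {x. \<phi> x \<noteq> 0} \<subseteq> \<Omega>}"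

definition is_distributional_derivative ::
    "(real^'d) set \<Rightarrow> (real^'d \<Rightarrow> real) \<Rightarrow> ((real^'d) set \<Rightarrow> real^'d) \<Rightarrow> bool" where
  "is_distributional_derivative \<Omega> u \<mu> \<longleftrightarrow>
     (\<forall>\<phi>\<in>test_functions \<Omega>. \<forall>i.
        (\<integral>x. u x * partial_derivative i \<phi> x \<partial>lebesgue_on \<Omega>) =
        - signed_integral (restrict_space borel \<Omega>) (\<lambda>A. \<mu> A $ i) \<phi>)"

definition BV :: "(real^'d) set \<Rightarrow> (real^'d \<Rightarrow> real) set" where
  "BV \<Omega> = {u. integrable (lebesgue_on \<Omega>) u \<and>
              (\<exists>\<mu>. finite_radon_measure \<Omega> \<mu> \<and> is_distributional_derivative \<Omega> u \<mu>)}"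

text \<open>For \<open>u \<in> BV \<Omega>\<close> the choice is unique on Borel subsets of \<open>\<Omega>\<close>, the only sets on which values matter.\<close>

definition distributional_derivative ::
    "(real^'d) set \<Rightarrow> (real^'d \<Rightarrow> real) \<Rightarrow> (real^'d) set \<Rightarrow> real^'d" where
  "distributional_derivative \<Omega> u =
     (SOME \<mu>. finite_radon_measure \<Omega> \<mu> \<and> is_distributional_derivative \<Omega> u \<mu>)"

text \<open>For \<open>f \<in> L\<^sup>2\<close> the first integral is \<open>\<infinity>\<close> exactly when \<open>u\<close> is not in \<open>L\<^sup>2\<close>.\<close>

definition fidelity_and_TV ::
    "(real^'d) set \<Rightarrow> real \<Rightarrow> (real^'d \<Rightarrow> real) \<Rightarrow>
     (real^'d \<Rightarrow> real^'d) \<Rightarrow> (real^'d \<Rightarrow> real) \<Rightarrow> ennreal" where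
  "fidelity_and_TV \<Omega> \<alpha> f w u =
     ennreal (1 / 2) * (\<integral>\<^sup>+x. ennreal ((f x - u x)\<^sup>2) \<partial>lebesgue_on \<Omega>) +
     ennreal \<alpha> * radon_norm \<Omega> (\<lambda>A. distributional_derivative \<Omega> u A - density_measure \<Omega> w A)"

definition p_homogeneous_energy ::
    "(real^'d) set \<Rightarrow> real \<Rightarrow> real \<Rightarrow> real \<Rightarrow> (real^'d \<Rightarrow> real) \<Rightarrow>
     (real^'d \<Rightarrow> real^'d) \<times> (real^'d \<Rightarrow> real) \<Rightarrow> ennreal" where
  "p_homogeneous_energy \<Omega> p \<alpha> \<beta> f =
     (\<lambda>(w, u). fidelity_and_TV \<Omega> \<alpha> f w u + ennreal (\<beta> / p * Lp_norm p \<Omega> w powr p))"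

definition one_homogeneous_energy ::
    "(real^'d) set \<Rightarrow> real \<Rightarrow> real \<Rightarrow> real \<Rightarrow> (real^'d \<Rightarrow> real) \<Rightarrow>
     (real^'d \<Rightarrow> real^'d) \<times> (real^'d \<Rightarrow> real) \<Rightarrow> ennreal" where
  "one_homogeneous_energy \<Omega> p \<alpha> \<beta> f =
     (\<lambda>(w, u). fidelity_and_TV \<Omega> \<alpha> f w u + ennreal (\<beta> * Lp_norm p \<Omega> w))"

end

theory Submission
  imports Defs
begin

text \<open>The sum \<open>F\<close> of the fidelity and total variation terms is jointly convex in \<open>(w, u)\<close>. Let \<open>a\<close> and
  \<open>b\<close> be the \<open>L\<^sup>p\<close> norms of \<open>w\<^sup>*\<close> and \<open>w\<close>, and put \<open>\<phi>(s) = \<beta>\<^sub>p s\<^sup>p / p\<close>, so that the second problem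
  replaces \<open>\<phi>\<close> by its tangent at \<open>a\<close>. One implication is \<open>\<phi>(b) - \<phi>(a) \<ge> \<phi>'(a) (b - a)\<close>, which is
  Young's inequality. For the other, compare the minimiser with the convex combinations
  \<open>(1 - t) (w\<^sup>*, u\<^sup>*) + t (w, u)\<close>: convexity gives
  \<open>t (F(w\<^sup>*, u\<^sup>*) - F(w, u)) \<le> \<phi>(a + t (b - a)) - \<phi>(a)\<close>, and one divides by \<open>t\<close> and lets \<open>t\<close> tend to \<open>0\<close>.
  As \<open>Du\<close> is a chosen representing measure, convexity of \<open>F\<close> requires its uniqueness, hence
  sufficiently many test functions.\<close>

subsection \<open>Smooth functions of compact support\<close>

lemma partial_derivativeI:
  assumes "(\<phi> has_derivative D) (at x)"
  shows "partial_derivative i \<phi> x = D (axis i 1)"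
  unfolding partial_derivative_def using frechet_derivative_at[OF assms] by simp

lemma differentiable_on_UNIV_has_derivative:
  assumes "\<phi> differentiable_on UNIV"
  shows "(\<phi> has_derivative frechet_derivative \<phi> (at x)) (at x)"
  using assms frechet_derivative_works unfolding differentiable_on_def by auto

text \<open>The successor clause of \<open>k_times_cont_diff\<close> asks for differentiability
  alone, so continuity has to be recovered from it at the lowest order. The product rule needs this,
  because one factor stays undifferentiated in each of its terms.\<close>

lemma k_times_cont_diff_SucD: "k_times_cont_diff (Suc k) \<phi> \<Longrightarrow> k_times_cont_diff k \<phi>"
proof (induction k arbitrary: \<phi>)
  case 0
  then show ?case by (auto intro: differentiable_imp_continuous_on)
next
  case (Suc k)
  then show ?case using k_times_cont_diff.simps(2) by blast
qed

lemma k_times_cont_diff_const: "k_times_cont_diff k (\<lambda>x :: real^'d. c)"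
proof (induction k arbitrary: c)
  case (Suc k)
  have "partial_derivative i (\<lambda>x :: real^'d. c) = (\<lambda>x. 0)" for i
    by (rule ext, rule partial_derivativeI) (rule has_derivative_const)
  with Suc show ?case by simp
qed simp

lemma k_times_cont_diff_add:
  "k_times_cont_diff k \<phi> \<Longrightarrow> k_times_cont_diff k \<psi> \<Longrightarrow> k_times_cont_diff k (\<lambda>x. \<phi> x + \<psi> x)"
proof (induction k arbitrary: \<phi> \<psi>)
  case 0
  then show ?case by (auto intro: continuous_on_add)
next
  case (Suc k)
  have "partial_derivative i (\<lambda>x. \<phi> x + \<psi> x) =
      (\<lambda>x. partial_derivative i \<phi> x + partial_derivative i \<psi> x)" for i
  proof
    fix x
    show "partial_derivative i (\<lambda>x. \<phi> x + \<psi> x) x =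
      partial_derivative i \<phi> x + partial_derivative i \<psi> x"
      unfolding partial_derivative_def[of i \<phi>] partial_derivative_def[of i \<psi>]
      by (rule partial_derivativeI, rule has_derivative_add)
        (use Suc.prems in \<open>auto intro: differentiable_on_UNIV_has_derivative\<close>)
  qed
  with Suc show ?case by auto
qed

lemma k_times_cont_diff_mult:
  "k_times_cont_diff k \<phi> \<Longrightarrow> k_times_cont_diff k \<psi> \<Longrightarrow> k_times_cont_diff k (\<lambda>x. \<phi> x * \<psi> x)"
proof (induction k arbitrary: \<phi> \<psi>)
  case 0
  then show ?case by (auto intro: continuous_on_mult)
next
  case (Suc k)
  have "partial_derivative i (\<lambda>x. \<phi> x * \<psi> x) =
      (\<lambda>x. \<phi> x * partial_derivative i \<psi> x + partial_derivative i \<phi> x * \<psi> x)" for i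
  proof
    fix x
    show "partial_derivative i (\<lambda>x. \<phi> x * \<psi> x) x =
      \<phi> x * partial_derivative i \<psi> x + partial_derivative i \<phi> x * \<psi> x"
      unfolding partial_derivative_def[of i \<phi>] partial_derivative_def[of i \<psi>]
      by (rule partial_derivativeI, rule has_derivative_mult)
        (use Suc.prems in \<open>auto intro: differentiable_on_UNIV_has_derivative\<close>)
  qed
  moreover have "k_times_cont_diff k \<phi>" "k_times_cont_diff k \<psi>"
    using Suc.prems by (auto dest: k_times_cont_diff_SucD simp del: k_times_cont_diff.simps)
  ultimately show ?case using Suc by (auto intro!: k_times_cont_diff_add)
qed

lemma k_times_cont_diff_diff:
  "k_times_cont_diff k \<phi> \<Longrightarrow> k_times_cont_diff k \<psi> \<Longrightarrow> k_times_cont_diff k (\<lambda>x. \<phi> x - \<psi> x)"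
  using k_times_cont_diff_add[of k \<phi> "\<lambda>x. (-1) * \<psi> x"]
    k_times_cont_diff_mult[OF k_times_cont_diff_const, of k \<psi> "-1"] by simp

lemma k_times_cont_diff_power:
  "k_times_cont_diff k \<phi> \<Longrightarrow> k_times_cont_diff k (\<lambda>x. \<phi> x ^ n)"
  by (induction n) (auto intro: k_times_cont_diff_const k_times_cont_diff_mult)

lemma k_times_cont_diff_prod:
  "(\<And>j. j \<in> J \<Longrightarrow> k_times_cont_diff k (\<phi> j)) \<Longrightarrow> k_times_cont_diff k (\<lambda>x. \<Prod>j\<in>J. \<phi> j x)"
  by (induction J rule: infinite_finite_induct)
    (auto intro: k_times_cont_diff_const k_times_cont_diff_mult)

lemma k_times_cont_diff_coordinate: "k_times_cont_diff k (\<lambda>x :: real^'d. x $ j)"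
proof (cases k)
  case (Suc l)
  have "partial_derivative i (\<lambda>x :: real^'d. x $ j) = (\<lambda>x. axis i 1 $ j)" for i
    by (rule ext, rule partial_derivativeI)
      (auto intro: bounded_linear_imp_has_derivative bounded_linear_vec_nth)
  moreover have "(\<lambda>x :: real^'d. x $ j) differentiable_on UNIV"
    by (auto intro!: linear_imp_differentiable_on bounded_linear.linear bounded_linear_vec_nth)
  ultimately show ?thesis using Suc by (simp add: k_times_cont_diff_const)
qed (auto intro!: continuous_intros)

text \<open>Including the factors \<open>s\<^sup>-\<^sup>n\<close> makes this family closed under derivatives up to linear
  combinations.\<close>

definition flat_exp :: "nat \<Rightarrow> real \<Rightarrow> real" where
  "flat_exp n s = (if 0 < s then inverse s ^ n * exp (- inverse s) else 0)"

text \<open>From the left the function vanishes. From the right, \<open>r = inverse s\<close> tends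
  to infinity and the exponential beats the power \<open>r ^ n\<close>.\<close>

lemma flat_exp_tendsto_0: "(flat_exp n \<longlongrightarrow> 0) (at 0)"
proof (rule filterlim_split_at_real)
  show "(flat_exp n \<longlongrightarrow> 0) (at_left 0)"
    by (rule tendsto_eventually) (auto simp: flat_exp_def eventually_at_filter)
  have "((\<lambda>s. inverse s ^ n / exp (inverse s)) \<longlongrightarrow> (0::real)) (at_right 0)"
    by (rule filterlim_compose[OF tendsto_power_div_exp_0 filterlim_inverse_at_top_right])
  moreover have "\<forall>\<^sub>F s in at_right (0::real). inverse s ^ n / exp (inverse s) = flat_exp n s"
    by (auto simp: flat_exp_def eventually_at_filter exp_minus divide_inverse)
  ultimately show "(flat_exp n \<longlongrightarrow> 0) (at_right 0)"
    by (rule Lim_transform_eventually)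
qed

lemma flat_exp_has_derivative:
  "(flat_exp n has_real_derivative flat_exp (n + 2) s - n * flat_exp (n + 1) s) (at s)"
proof -
  consider "s > 0" | "s < 0" | "s = 0" by linarith
  then show ?thesis
  proof cases
    case 1
    have "((\<lambda>s. inverse s ^ n * exp (- inverse s)) has_real_derivative
        flat_exp (n + 2) s - n * flat_exp (n + 1) s) (at s)"
    \<comment> \<open>The power rule produces the exponent \<open>n - 1\<close>, which is truncated
      at \<open>n = 0\<close>.\<close>
    proof (cases n)
      case 0
      then show ?thesis
        using 1 by (auto intro!: derivative_eq_intros simp: flat_exp_def power2_eq_square)
    next
      case (Suc m)
      then show ?thesis
        using 1 by (auto intro!: derivative_eq_intros simp: flat_exp_def algebra_simps
            simp flip: power_Suc)
    qed
    then show ?thesis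
      by (rule has_field_derivative_transform_within_open[where S = "{0<..}"])
        (use 1 in \<open>auto simp: flat_exp_def\<close>)
  next
    case 2
    have "((\<lambda>s. 0) has_real_derivative flat_exp (n + 2) s - n * flat_exp (n + 1) s) (at s)"
      using 2 by (auto simp: flat_exp_def)
    then show ?thesis
      by (rule has_field_derivative_transform_within_open[where S = "{..<0}"])
        (use 2 in \<open>auto simp: flat_exp_def\<close>)
  next
    \<comment> \<open>The difference quotient of \<open>flat_exp n\<close> at 0 is
      \<open>flat_exp (n + 1)\<close> itself, so the limit already proved gives derivative
      0.\<close>
    case 3
    have "\<forall>\<^sub>F y in at 0. flat_exp (n + 1) y = (flat_exp n y - flat_exp n 0) / (y - 0)"
      by (auto simp: flat_exp_def eventually_at_filter divide_inverse)
    with flat_exp_tendsto_0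
    have "((\<lambda>y. (flat_exp n y - flat_exp n 0) / (y - 0)) \<longlongrightarrow> 0) (at 0)"
      by (rule Lim_transform_eventually)
    then show ?thesis using 3 by (simp add: has_field_derivative_iff flat_exp_def)
  qed
qed

text \<open>The squared distance makes the argument of \<open>flat_exp\<close> a polynomial in
  \<open>x\<close>, so that smoothness holds at the centre too. Only \<open>n = 0\<close> serves as
  a bump; the other indices occur in its derivatives.\<close>

definition ball_bump :: "nat \<Rightarrow> real^'d \<Rightarrow> real \<Rightarrow> real^'d \<Rightarrow> real" where
  "ball_bump n c r x = flat_exp n (r\<^sup>2 - (x - c) \<bullet> (x - c))"

lemma ball_bump_has_derivative:
  "(ball_bump n c r has_derivative (\<lambda>v. (ball_bump (n + 2) c r x - n * ball_bump (n + 1) c r x)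
      * (- 2 * ((x - c) \<bullet> v)))) (at x)"
  unfolding ball_bump_def
  by (rule has_derivative_compose[OF _ has_field_derivative_imp_has_derivative[OF
        flat_exp_has_derivative], THEN has_derivative_eq_rhs])
    (auto intro!: derivative_eq_intros simp: inner_commute)

text \<open>The induction treats all \<open>n\<close> at once: a partial derivative of a bump is a
  combination of bumps with indices \<open>n + 1\<close> and \<open>n + 2\<close>, multiplied by an
  affine function.\<close>

lemma k_times_cont_diff_ball_bump: "k_times_cont_diff k (ball_bump n c r)"
proof (induction k arbitrary: n)
  case 0
  show ?case
    using has_derivative_continuous[OF ball_bump_has_derivative]
    unfolding k_times_cont_diff.simps by (intro continuous_at_imp_continuous_on ballI)
next
  case (Suc k)
  have "partial_derivative i (ball_bump n c r) = (\<lambda>x. (ball_bump (n + 2) c r x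
      - n * ball_bump (n + 1) c r x) * (- 2 * (x $ i - c $ i)))" for i
    by (rule ext, subst partial_derivativeI[OF ball_bump_has_derivative])
      (simp add: inner_axis)
  moreover have "ball_bump n c r differentiable_on UNIV"
    unfolding differentiable_on_def differentiable_def using ball_bump_has_derivative by blast
  ultimately show ?case
    by (auto intro!: k_times_cont_diff_mult k_times_cont_diff_diff k_times_cont_diff_const
        k_times_cont_diff_coordinate Suc)
qed

lemma flat_exp_0_bounds: "0 \<le> flat_exp 0 s" "flat_exp 0 s < 1"
  by (auto simp: flat_exp_def)

lemma ball_bump_0_bounds: "0 \<le> ball_bump 0 c r x" "ball_bump 0 c r x < 1"
  unfolding ball_bump_def by (rule flat_exp_0_bounds)+

lemma ball_bump_0_pos_iff:
  assumes "0 < r"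
  shows "0 < ball_bump 0 c r x \<longleftrightarrow> x \<in> ball c r"
proof -
  have "x \<in> ball c r \<longleftrightarrow> (norm (x - c))\<^sup>2 < r\<^sup>2"
    using assms power_strict_mono[of "norm (x - c)" r 2] power_less_imp_less_base[of "norm (x - c)" 2 r]
    by (auto simp: dist_norm norm_minus_commute)
  then show ?thesis by (simp add: ball_bump_def flat_exp_def dot_square_norm)
qed

text \<open>Cover \<open>U\<close> by countably many balls with bumps \<open>\<psi> j\<close> taking
  values in [0, 1). The product of \<open>1 - \<psi> j\<close> over \<open>j < k\<close> equals 1
  away from the first \<open>k\<close> balls and is less than 1 inside them; raising it to the power
  \<open>k\<close> drives it to 0 at every point of \<open>U\<close>.\<close>

lemma test_function_indicator_sequence:
  fixes U :: "(real^'d) set"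
  assumes "open U"
  obtains \<Phi> where "\<And>k. \<Phi> k \<in> test_functions U" "\<And>k x. 0 \<le> \<Phi> k x" "\<And>k x. \<Phi> k x \<le> 1"
    "\<And>x. (\<lambda>k. \<Phi> k x) \<longlonglongrightarrow> indicator U x"
proof -
  \<comment> \<open>Closed balls inside \<open>U\<close> are chosen so that finite unions of them
    are compact subsets of \<open>U\<close> and can contain the supports.\<close>
  have "\<exists>r>0. cball x r \<subseteq> U" if "x \<in> U" for x
    using that assms open_contains_cball by blast
  then obtain r where r: "\<And>x. x \<in> U \<Longrightarrow> 0 < r x" "\<And>x. x \<in> U \<Longrightarrow> cball x (r x) \<subseteq> U"
    by metis
  obtain F where F: "F \<subseteq> (\<lambda>x. ball x (r x)) ` U" "countable F"
      "\<Union>F = \<Union>((\<lambda>x. ball x (r x)) ` U)"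
    by (rule Lindelof[of "(\<lambda>x. ball x (r x)) ` U"]) auto
  have UF: "\<Union>F = U"
    unfolding F(3) using r by (force simp: subset_eq less_imp_le)
  show thesis
  \<comment> \<open>The empty set has no balls to enumerate; there the zero sequence serves.\<close>
  proof (cases "U = {}")
    case True
    show thesis
      by (rule that[of "\<lambda>_ _. 0"]) (auto simp: True test_functions_def k_times_cont_diff_const)
  next
    case False
    then have "F \<noteq> {}" using UF by auto
    define B where "B = from_nat_into F"
    have "range B = F" unfolding B_def using \<open>F \<noteq> {}\<close> F(2) by (rule range_from_nat_into)
    then have "\<exists>c. \<forall>j. c j \<in> U \<and> B j = ball (c j) (r (c j))"
      using F(1) by (intro choice) blast
    then obtain c where c: "\<And>j. c j \<in> U" "\<And>j. B j = ball (c j) (r (c j))" by auto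
    define \<psi> where "\<psi> j = ball_bump 0 (c j) (r (c j))" for j
    have \<psi>: "0 \<le> \<psi> j x" "\<psi> j x < 1" for j x
      unfolding \<psi>_def by (rule ball_bump_0_bounds)+
    have \<psi>_pos: "0 < \<psi> j x \<longleftrightarrow> x \<in> B j" for j x
      unfolding \<psi>_def c(2) using ball_bump_0_pos_iff r(1) c(1) by blast
    define \<Phi> where "\<Phi> k x = 1 - (\<Prod>j<k. 1 - \<psi> j x) ^ k" for k x
    have prod: "0 \<le> (\<Prod>j<k. 1 - \<psi> j x)" "(\<Prod>j<k. 1 - \<psi> j x) \<le> 1" for k x
      using \<psi> by (auto intro!: prod_nonneg prod_le_1 simp: less_imp_le)
    show thesis
    proof (rule that)
      fix k
      let ?K = "\<Union>j<k. cball (c j) (r (c j))"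
      have sub: "{x. \<Phi> k x \<noteq> 0} \<subseteq> ?K"
      proof
        fix x assume "x \<in> {x. \<Phi> k x \<noteq> 0}"
        then have "(\<Prod>j<k. 1 - \<psi> j x) \<noteq> 1" by (auto simp: \<Phi>_def)
        moreover have "(\<Prod>j<k. 1 - \<psi> j x) = 1" if "\<forall>j<k. \<psi> j x = 0"
          using that by (intro prod.neutral) auto
        ultimately have "\<not> (\<forall>j<k. \<psi> j x = 0)" by blast
        then obtain j where "j < k" "\<psi> j x \<noteq> 0" by blast
        then have "x \<in> B j" using \<psi>_pos[of j x] \<psi>(1)[of j x] by auto
        then show "x \<in> ?K" using \<open>j < k\<close> c(2) by (auto intro!: bexI[of _ j])
      qed
      have "compact ?K" by auto
      then have "closed ?K" by (rule compact_imp_closed)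
      with sub have clo: "closure {x. \<Phi> k x \<noteq> 0} \<subseteq> ?K" by (rule closure_minimal)
      with \<open>compact ?K\<close> have "compact (closure {x. \<Phi> k x \<noteq> 0})"
        using compact_Int_closed[of ?K "closure {x. \<Phi> k x \<noteq> 0}"] by (simp add: inf.absorb2)
      moreover have "k_times_cont_diff l (\<Phi> k)" for l
        unfolding \<Phi>_def \<psi>_def
        by (intro k_times_cont_diff_diff k_times_cont_diff_const k_times_cont_diff_power
            k_times_cont_diff_prod k_times_cont_diff_ball_bump)
      moreover have "?K \<subseteq> U" using r(2) c(1) by blast
      ultimately show "\<Phi> k \<in> test_functions U"
        using clo by (auto simp: test_functions_def)
    next
      show "0 \<le> \<Phi> k x" for k x unfolding \<Phi>_def using prod[of x k] by (simp add: power_le_one)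
      show "\<Phi> k x \<le> 1" for k x unfolding \<Phi>_def using prod[of x k] by simp
    next
      fix x
      show "(\<lambda>k. \<Phi> k x) \<longlonglongrightarrow> indicator U x"
      proof (cases "x \<in> U")
        case True
        then obtain j where j: "x \<in> B j" using UF \<open>range B = F\<close> by blast
        have lim: "(\<lambda>k. (1 - \<psi> j x) ^ k) \<longlonglongrightarrow> 0"
          using \<psi>[of j x] \<psi>_pos[of j x] j by (intro LIMSEQ_realpow_zero) auto
        \<comment> \<open>Once \<open>k > j\<close>, the product is at most its factor with index
          \<open>j\<close>, which does not depend on \<open>k\<close> and is less than 1.\<close>
        have le: "\<forall>\<^sub>F k in sequentially. (\<Prod>j<k. 1 - \<psi> j x) ^ k \<le> (1 - \<psi> j x) ^ k"
          using eventually_gt_at_top[of j]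
        proof eventually_elim
          case (elim k)
          have "(\<Prod>i<k. 1 - \<psi> i x) = (1 - \<psi> j x) * (\<Prod>i\<in>{..<k} - {j}. 1 - \<psi> i x)"
            using elim by (simp add: prod.remove)
          also have "\<dots> \<le> (1 - \<psi> j x) * 1"
            using \<psi> by (intro mult_left_mono prod_le_1) (auto simp: less_imp_le)
          finally show ?case using prod by (intro power_mono) auto
        qed
        have ge: "\<forall>\<^sub>F k in sequentially. 0 \<le> (\<Prod>j<k. 1 - \<psi> j x) ^ k"
          using prod by simp
        from ge le tendsto_const lim have "(\<lambda>k. (\<Prod>j<k. 1 - \<psi> j x) ^ k) \<longlonglongrightarrow> 0"
          by (rule tendsto_sandwich)
        from tendsto_diff[OF tendsto_const this, of 1] True show ?thesis
          by (simp add: \<Phi>_def)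
      next
        case False
        then have "\<psi> j x = 0" for j
          using \<psi>_pos[of j x] \<psi>(1)[of j x] UF \<open>range B = F\<close> by (auto simp: less_le)
        with False show ?thesis by (simp add: \<Phi>_def)
      qed
    qed
  qed
qed

subsection \<open>Finite vector measures\<close>

text \<open>The bound holds on each partition, before suprema are taken. Assuming only an inequality
  between norms on single sets lets the lemma serve for finiteness of combinations and of components
  as well as for convexity of the total variation term.\<close>

lemma variation_le_combination:
  assumes "0 \<le> a" "0 \<le> b"
    and "\<And>A. A \<in> sets M \<Longrightarrow> norm (\<rho> A) \<le> a * norm (\<mu> A) + b * norm (\<nu> A)"
  shows "variation M \<rho> S \<le> ennreal a * variation M \<mu> S + ennreal b * variation M \<nu> S"
  unfolding variation_def[of M \<rho>]
proof (rule SUP_least)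
  fix B :: "nat \<Rightarrow> 'a set"
  assume B: "B \<in> {B. range B \<subseteq> sets M \<and> disjoint_family B \<and> (\<Union>n. B n) = S}"
  have "(\<Sum>n. ennreal (norm (\<rho> (B n)))) \<le>
      (\<Sum>n. ennreal a * ennreal (norm (\<mu> (B n))) + ennreal b * ennreal (norm (\<nu> (B n))))"
  proof (intro suminf_le summableI)
    fix n
    have "norm (\<rho> (B n)) \<le> a * norm (\<mu> (B n)) + b * norm (\<nu> (B n))"
      using B assms(3) by blast
    then show "ennreal (norm (\<rho> (B n))) \<le>
        ennreal a * ennreal (norm (\<mu> (B n))) + ennreal b * ennreal (norm (\<nu> (B n)))"
      using assms(1,2) by (simp add: ennreal_leI flip: ennreal_mult ennreal_plus)
  qed
  also have "\<dots> = ennreal a * (\<Sum>n. ennreal (norm (\<mu> (B n)))) +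
      ennreal b * (\<Sum>n. ennreal (norm (\<nu> (B n))))"
    by (simp only: suminf_add[symmetric, OF summableI summableI] ennreal_suminf_cmult)
  also have "\<dots> \<le> ennreal a * variation M \<mu> S + ennreal b * variation M \<nu> S"
    unfolding variation_def using B by (intro add_mono mult_left_mono SUP_upper) auto
  finally show "(\<Sum>n. ennreal (norm (\<rho> (B n)))) \<le>
      ennreal a * variation M \<mu> S + ennreal b * variation M \<nu> S" .
qed

lemma finite_vector_measure_combination:
  assumes "finite_vector_measure M \<mu>" "finite_vector_measure M \<nu>"
    and eq: "\<And>A. A \<in> sets M \<Longrightarrow> \<rho> A = a *\<^sub>R \<mu> A + b *\<^sub>R \<nu> A"
  shows "finite_vector_measure M \<rho>"
  unfolding finite_vector_measure_def
proof (intro conjI allI impI)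
  fix A :: "nat \<Rightarrow> 'a set" assume A: "range A \<subseteq> sets M" "disjoint_family A"
  then have "(\<lambda>n. a *\<^sub>R \<mu> (A n) + b *\<^sub>R \<nu> (A n)) sums
      (a *\<^sub>R \<mu> (\<Union>n. A n) + b *\<^sub>R \<nu> (\<Union>n. A n))"
    using assms(1,2) by (intro sums_add sums_scaleR_right) (auto simp: finite_vector_measure_def)
  moreover have "A n \<in> sets M" for n using A by auto
  moreover from this have "(\<Union>n. A n) \<in> sets M" by blast
  ultimately show "(\<lambda>n. \<rho> (A n)) sums \<rho> (\<Union>n. A n)"
    by (simp add: eq)
next
  have "variation M \<rho> (space M) \<le>
      ennreal \<bar>a\<bar> * variation M \<mu> (space M) + ennreal \<bar>b\<bar> * variation M \<nu> (space M)"
    by (rule variation_le_combination) (auto simp: eq intro: order_trans[OF norm_triangle_ineq])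
  also have "\<dots> < \<infinity>"
    using assms(1,2) by (auto simp: finite_vector_measure_def ennreal_mult_less_top)
  finally show "variation M \<rho> (space M) < \<infinity>" .
qed

lemma finite_vector_measure_component:
  fixes \<mu> :: "'a set \<Rightarrow> real^'d"
  assumes "finite_vector_measure M \<mu>"
  shows "finite_vector_measure M (\<lambda>A. \<mu> A $ i)"
proof -
  \<comment> \<open>The second summand is a dummy with coefficient 0.\<close>
  have "variation M (\<lambda>A. \<mu> A $ i) (space M) \<le>
      ennreal 1 * variation M \<mu> (space M) + ennreal 0 * variation M \<mu> (space M)"
    by (rule variation_le_combination) (auto simp: component_le_norm_cart)
  then have "variation M (\<lambda>A. \<mu> A $ i) (space M) < \<infinity>"
    using assms by (auto simp: finite_vector_measure_def)
  moreover have "(\<lambda>n. \<mu> (A n) $ i) sums (\<mu> (\<Union>n. A n) $ i)"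
    if "range A \<subseteq> sets M" "disjoint_family A" for A
    using assms that
    by (intro bounded_linear.sums[OF bounded_linear_vec_nth]) (auto simp: finite_vector_measure_def)
  ultimately show ?thesis by (simp add: finite_vector_measure_def)
qed

lemma finite_vector_measure_sums:
  assumes "finite_vector_measure M \<nu>" "range A \<subseteq> sets M" "disjoint_family A"
  shows "(\<lambda>n. \<nu> (A n)) sums \<nu> (\<Union>n. A n)"
  using assms by (auto simp: finite_vector_measure_def)

text \<open>The sequence of empty sets is disjoint, and a constant series converges only if its
  terms vanish.\<close>

lemma finite_vector_measure_empty:
  assumes "finite_vector_measure M \<nu>"
  shows "\<nu> {} = 0"
proof -
  have "(\<lambda>n :: nat. \<nu> {}) sums \<nu> (\<Union>n :: nat. {})"
    by (rule finite_vector_measure_sums[OF assms]) (auto simp: disjoint_family_on_def)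
  then show ?thesis by (auto dest: sums_summable simp: summable_const_iff)
qed

lemma finite_vector_measure_Un:
  assumes "finite_vector_measure M \<nu>" "A \<in> sets M" "B \<in> sets M" "A \<inter> B = {}"
  shows "\<nu> (A \<union> B) = \<nu> A + \<nu> B"
proof -
  have "disjoint_family (binaryset A B)"
    using assms(4) by (auto simp: disjoint_family_on_def binaryset_def)
  then have "(\<lambda>n. \<nu> (binaryset A B n)) sums \<nu> (\<Union>n. binaryset A B n)"
    using assms by (intro finite_vector_measure_sums) (auto simp: range_binaryset_eq)
  moreover have "(\<lambda>n. \<nu> (binaryset A B n)) sums (\<nu> A + \<nu> B)"
    by (rule binaryset_sums) (rule finite_vector_measure_empty[OF assms(1)])
  ultimately show ?thesis by (auto simp: UN_binaryset_eq dest: sums_unique2)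
qed

text \<open>The sequence \<open>A\<close>, its complement, and then empty sets is one of the
  partitions in the supremum; its first term alone gives the bound.\<close>

lemma norm_le_variation:
  assumes "finite_vector_measure M \<nu>" "A \<in> sets M"
  shows "ennreal (norm (\<nu> A)) \<le> variation M \<nu> (space M)"
proof -
  let ?B = "binaryset A (space M - A)"
  have "ennreal (norm (\<nu> A)) = (\<Sum>n\<in>{0}. ennreal (norm (\<nu> (?B n))))"
    by (simp add: binaryset_def)
  also have "\<dots> \<le> (\<Sum>n. ennreal (norm (\<nu> (?B n))))"
    by (rule sum_le_suminf[OF summableI]) simp_all
  also have "\<dots> \<le> variation M \<nu> (space M)"
    unfolding variation_def
  proof (intro SUP_upper CollectI conjI)
    show "range ?B \<subseteq> sets M" unfolding range_binaryset_eq using assms(2) by auto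
    show "disjoint_family ?B" by (auto simp: disjoint_family_on_def binaryset_def)
    show "(\<Union>n. ?B n) = space M"
      unfolding UN_binaryset_eq using sets.sets_into_space[OF assms(2)] by (rule Diff_partition)
  qed
  finally show ?thesis .
qed

subsection \<open>The Jordan decomposition\<close>

text \<open>Since \<open>ennreal\<close> sends negative reals to 0, it is subadditive, which gives
  the bound for partial sums; continuity carries it to the limit. The right-hand side may be
  infinite.\<close>

lemma ennreal_sums_le:
  assumes "f sums s"
  shows "ennreal s \<le> (\<Sum>n. ennreal (f n))"
proof -
  have le: "ennreal (\<Sum>i<n. f i) \<le> (\<Sum>i<n. ennreal (f i))" for n
  proof (induction n)
    case (Suc n)
    have "ennreal (x + y) \<le> ennreal x + ennreal y" for x y :: real
      by (cases "0 \<le> x"; cases "0 \<le> y")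
        (auto simp: ennreal_neg intro: ennreal_leI simp flip: ennreal_plus)
    from order_trans[OF this add_right_mono[OF Suc]] show ?case by simp
  qed simp
  have "(\<lambda>n. ennreal (\<Sum>i<n. f i)) \<longlonglongrightarrow> ennreal s"
    using assms by (intro tendsto_ennrealI) (simp add: sums_def)
  then show ?thesis
    by (rule LIMSEQ_le_const2)
      (auto intro!: exI[of _ 0] order_trans[OF le] sum_le_suminf)
qed

context
  fixes M :: "'a measure" and \<nu> :: "'a set \<Rightarrow> real"
  assumes fin: "finite_vector_measure M \<nu>"
begin

text \<open>This is the set function passed to \<open>measure_of\<close> in
  \<open>positive_part\<close>. It has a name because \<open>measure_of\<close> returns it as the
  measure only once countable additivity is established.\<close>

definition upper_variation :: "'a set \<Rightarrow> ennreal" where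
  "upper_variation A = (SUP B\<in>{B \<in> sets M. B \<subseteq> A}. ennreal (\<nu> B))"

lemma upper_variation_upper: "B \<in> sets M \<Longrightarrow> B \<subseteq> A \<Longrightarrow> ennreal (\<nu> B) \<le> upper_variation A"
  unfolding upper_variation_def by (intro SUP_upper) auto

text \<open>Competitors for two disjoint sets are disjoint themselves, so their union competes for
  the union of the sets with the sum of the two values.\<close>

lemma upper_variation_superadditive:
  assumes "A1 \<inter> A2 = {}"
  shows "upper_variation A1 + upper_variation A2 \<le> upper_variation (A1 \<union> A2)"
proof -
  \<comment> \<open>A competitor of negative value counts as 0 under \<open>ennreal\<close>, so the
    empty set can replace it; on nonnegative values \<open>ennreal\<close> is additive.\<close>
  have pos: "\<exists>B'\<in>sets M. B' \<subseteq> B \<and> ennreal (\<nu> B) = ennreal (\<nu> B') \<and> 0 \<le> \<nu> B'"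
    if "B \<in> sets M" for B
  proof (cases "0 \<le> \<nu> B")
    case False
    then show ?thesis
      by (intro bexI[of _ "{}"]) (auto simp: ennreal_neg finite_vector_measure_empty[OF fin])
  qed (use that in auto)
  have le: "ennreal (\<nu> B1) + ennreal (\<nu> B2) \<le> upper_variation (A1 \<union> A2)"
    if B: "B1 \<in> sets M" "B1 \<subseteq> A1" "B2 \<in> sets M" "B2 \<subseteq> A2" for B1 B2
  proof -
    obtain C1 C2 where C: "C1 \<in> sets M" "C1 \<subseteq> B1" "ennreal (\<nu> B1) = ennreal (\<nu> C1)" "0 \<le> \<nu> C1"
      "C2 \<in> sets M" "C2 \<subseteq> B2" "ennreal (\<nu> B2) = ennreal (\<nu> C2)" "0 \<le> \<nu> C2"
      using pos[OF B(1)] pos[OF B(3)] by auto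
    have "C1 \<inter> C2 = {}" using C B assms by blast
    then have "\<nu> (C1 \<union> C2) = \<nu> C1 + \<nu> C2"
      using C by (intro finite_vector_measure_Un[OF fin])
    then have "ennreal (\<nu> B1) + ennreal (\<nu> B2) = ennreal (\<nu> (C1 \<union> C2))"
      using C by (simp add: ennreal_plus)
    also have "\<dots> \<le> upper_variation (A1 \<union> A2)"
      using C B by (intro upper_variation_upper) auto
    finally show ?thesis .
  qed
  have ne: "{B \<in> sets M. B \<subseteq> A} \<noteq> {}" for A by auto
  have "upper_variation A1 + upper_variation A2 =
      (SUP B1\<in>{B \<in> sets M. B \<subseteq> A1}. ennreal (\<nu> B1) + upper_variation A2)"
    unfolding upper_variation_def[of A1] by (rule ennreal_SUP_add_left[OF ne, symmetric])
  also have "\<dots> =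
      (SUP B1\<in>{B \<in> sets M. B \<subseteq> A1}. SUP B2\<in>{B \<in> sets M. B \<subseteq> A2}. ennreal (\<nu> B1) + ennreal (\<nu> B2))"
    unfolding upper_variation_def[of A2] by (simp only: ennreal_SUP_add_right[OF ne])
  also have "\<dots> \<le> upper_variation (A1 \<union> A2)"
    using le by (intro SUP_least) auto
  finally show ?thesis .
qed

text \<open>Superadditivity and monotonicity bound every partial sum by the value on the union.
  Conversely, a competitor \<open>B\<close> for the union is cut into the pieces
  \<open>B \<inter> A n\<close>, each of which competes for \<open>A n\<close>.\<close>

lemma upper_variation_countably_additive: "countably_additive (sets M) upper_variation"
  unfolding countably_additive_def
proof (intro allI impI antisym)
  fix A :: "nat \<Rightarrow> 'a set"
  assume A: "range A \<subseteq> sets M" "disjoint_family A" "\<Union> (range A) \<in> sets M"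
  have "(\<Sum>n<N. upper_variation (A n)) \<le> upper_variation (\<Union>n<N. A n)" for N
  proof (induction N)
    case (Suc N)
    have "A N \<inter> (\<Union>n<N. A n) = {}"
      using disjoint_family_onD[OF A(2), of N] by (auto simp: disjoint_iff)
    then have "upper_variation (A N) + upper_variation (\<Union>n<N. A n) \<le>
        upper_variation (A N \<union> (\<Union>n<N. A n))"
      by (rule upper_variation_superadditive)
    from order_trans[OF add_left_mono[OF Suc] this] show ?case
      by (simp add: lessThan_Suc add.commute)
  qed simp
  moreover have "upper_variation (\<Union>n<N. A n) \<le> upper_variation (\<Union> (range A))" for N
    unfolding upper_variation_def by (intro SUP_subset_mono) auto
  ultimately have "(\<Sum>n<N. upper_variation (A n)) \<le> upper_variation (\<Union> (range A))" for N
    by (rule order_trans)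
  then show "(\<Sum>n. upper_variation (A n)) \<le> upper_variation (\<Union> (range A))"
    unfolding suminf_eq_SUP by (rule SUP_least)
  show "upper_variation (\<Union> (range A)) \<le> (\<Sum>n. upper_variation (A n))"
    unfolding upper_variation_def[of "\<Union> (range A)"]
  proof (intro SUP_least)
    fix B assume B: "B \<in> {B \<in> sets M. B \<subseteq> \<Union> (range A)}"
    have "(\<lambda>n. \<nu> (B \<inter> A n)) sums \<nu> (\<Union>n. B \<inter> A n)"
      using A B by (intro finite_vector_measure_sums[OF fin]) (auto simp: disjoint_family_on_def)
    also have "(\<Union>n. B \<inter> A n) = B" using B by auto
    finally have "ennreal (\<nu> B) \<le> (\<Sum>n. ennreal (\<nu> (B \<inter> A n)))"
      by (rule ennreal_sums_le)
    also have "\<dots> \<le> (\<Sum>n. upper_variation (A n))"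
      using A B by (intro suminf_le summableI upper_variation_upper) auto
    finally show "ennreal (\<nu> B) \<le> (\<Sum>n. upper_variation (A n))" .
  qed
qed

lemma sets_positive_part: "sets (positive_part M \<nu>) = sets M"
  and space_positive_part: "space (positive_part M \<nu>) = space M"
  by (simp_all add: positive_part_def sets.space_closed)

lemma emeasure_positive_part:
  assumes "A \<in> sets M"
  shows "emeasure (positive_part M \<nu>) A = upper_variation A"
proof (rule emeasure_measure_of)
  show "positive_part M \<nu> = measure_of (space M) (sets M) upper_variation"
    by (simp add: positive_part_def upper_variation_def[abs_def])
  have "{B \<in> sets M. B \<subseteq> {}} = {{}}" by auto
  then show "positive (sets (positive_part M \<nu>)) upper_variation"
    by (simp add: positive_def upper_variation_def finite_vector_measure_empty[OF fin])
qed (use assms in \<open>auto simp: sets_positive_part upper_variation_countably_additive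
    dest: sets.sets_into_space\<close>)

lemma finite_measure_positive_part: "finite_measure (positive_part M \<nu>)"
proof (rule finite_measureI)
  have "upper_variation (space M) \<le> variation M \<nu> (space M)"
    unfolding upper_variation_def
  proof (intro SUP_least)
    fix B assume "B \<in> {B \<in> sets M. B \<subseteq> space M}"
    then show "ennreal (\<nu> B) \<le> variation M \<nu> (space M)"
      using order_trans[OF ennreal_leI[OF abs_ge_self] norm_le_variation[OF fin, of B, simplified]]
      by auto
  qed
  also have "\<dots> < \<infinity>" using fin by (simp add: finite_vector_measure_def)
  finally show "emeasure (positive_part M \<nu>) (space (positive_part M \<nu>)) \<noteq> \<infinity>"
    by (simp add: space_positive_part emeasure_positive_part)
qed

text \<open>This and \<open>measure_positive_part_least\<close> restate the supremum over subsets in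
  real numbers, where differences can be formed.\<close>

lemma measure_positive_part_upper:
  assumes "B \<in> sets M" "B \<subseteq> A" "A \<in> sets M"
  shows "\<nu> B \<le> measure (positive_part M \<nu>) A"
proof -
  interpret finite_measure "positive_part M \<nu>" by (rule finite_measure_positive_part)
  have "ennreal (\<nu> B) \<le> ennreal (measure (positive_part M \<nu>) A)"
    using upper_variation_upper[OF assms(1,2)] emeasure_positive_part[OF assms(3)]
    by (simp add: emeasure_eq_measure)
  then show ?thesis by (simp add: ennreal_le_iff)
qed

lemma measure_positive_part_least:
  assumes "A \<in> sets M" "\<And>B. B \<in> sets M \<Longrightarrow> B \<subseteq> A \<Longrightarrow> \<nu> B \<le> c"
  shows "measure (positive_part M \<nu>) A \<le> c"
proof -
  \<comment> \<open>The empty set is a competitor of value 0; nonnegativity is what lets the bound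
    by \<open>ennreal c\<close> return to \<open>c\<close>.\<close>
  have "0 \<le> c" using assms(2)[of "{}"] finite_vector_measure_empty[OF fin] by simp
  moreover have "upper_variation A \<le> ennreal c"
    unfolding upper_variation_def using assms(2) by (auto intro!: SUP_least ennreal_leI)
  ultimately show ?thesis
    by (simp add: measure_def emeasure_positive_part[OF assms(1)] enn2real_leI)
qed

end

lemma finite_vector_measure_uminus:
  assumes "finite_vector_measure M \<nu>"
  shows "finite_vector_measure M (\<lambda>A. - \<nu> A)"
  by (rule finite_vector_measure_combination[OF assms assms, where a = "-1" and b = 0]) simp

text \<open>For \<open>B \<subseteq> A\<close> one has
  \<open>\<nu> B = \<nu> A - \<nu> (A - B)\<close>, which is at most \<open>\<nu> A\<close> plus the
  negative part of \<open>A\<close>; taking the supremum over \<open>B\<close> gives one inequality.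
  The other follows in the same way from \<open>- \<nu> B = \<nu> (A - B) - \<nu> A\<close>.\<close>

lemma Jordan_decomposition:
  assumes "finite_vector_measure M \<nu>" "A \<in> sets M"
  shows "measure (positive_part M \<nu>) A - measure (positive_part M (\<lambda>A. - \<nu> A)) A = \<nu> A"
proof -
  have split: "\<nu> B + \<nu> (A - B) = \<nu> A" if "B \<in> sets M" "B \<subseteq> A" for B
    using finite_vector_measure_Un[OF assms(1) that(1), of "A - B"] that assms(2)
    by (simp add: Un_absorb1 sets.Diff)
  have "measure (positive_part M \<nu>) A \<le> \<nu> A + measure (positive_part M (\<lambda>A. - \<nu> A)) A"
  proof (rule measure_positive_part_least[OF assms])
    fix B assume B: "B \<in> sets M" "B \<subseteq> A"
    show "\<nu> B \<le> \<nu> A + measure (positive_part M (\<lambda>A. - \<nu> A)) A"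
      using measure_positive_part_upper[OF finite_vector_measure_uminus[OF assms(1)], of "A - B" A]
        split[OF B] B assms(2) by auto
  qed
  moreover have "measure (positive_part M (\<lambda>A. - \<nu> A)) A \<le> measure (positive_part M \<nu>) A - \<nu> A"
  proof (rule measure_positive_part_least[OF finite_vector_measure_uminus[OF assms(1)] assms(2)])
    fix B assume B: "B \<in> sets M" "B \<subseteq> A"
    show "- \<nu> B \<le> measure (positive_part M \<nu>) A - \<nu> A"
      using measure_positive_part_upper[OF assms(1), of "A - B" A] split[OF B] B assms(2) by auto
  qed
  ultimately show ?thesis by simp
qed

subsection \<open>Integration against signed measures\<close>

text \<open>On level sets the Jordan decomposition removes the positive parts, leaving an expression
  that is visibly linear in the measure.\<close>

lemma signed_integral_simple_function:
  assumes "finite_vector_measure M \<nu>" "simple_function M s"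
  shows "signed_integral M \<nu> s = (\<Sum>y\<in>s ` space M. y * \<nu> {x \<in> space M. s x = y})"
proof -
  have meas: "{x \<in> space M. s x = y} \<in> sets M" for y
    using simple_functionD(2)[OF assms(2), of "{y}"]
    by (simp add: vimage_def Int_def conj_commute)
  have int: "(\<integral>x. s x \<partial>positive_part M \<rho>) =
      (\<Sum>y\<in>s ` space M. y * measure (positive_part M \<rho>) {x \<in> space M. s x = y})"
    if "finite_vector_measure M \<rho>" for \<rho>
  proof -
    interpret finite_measure "positive_part M \<rho>"
      by (rule finite_measure_positive_part[OF that])
    have "simple_function (positive_part M \<rho>) s"
      using assms(2) sets_positive_part[OF that] space_positive_part[OF that]
        simple_function_cong_algebra by blast
    then have "Bochner_Integration.simple_bochner_integrable (positive_part M \<rho>) s"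
      by (simp add: Bochner_Integration.simple_bochner_integrable.simps)
    from simple_bochner_integrable_eq_integral[OF this] show ?thesis
      by (simp add: Bochner_Integration.simple_bochner_integral_def space_positive_part[OF that] mult.commute)
  qed
  show ?thesis
    unfolding signed_integral_def int[OF assms(1)] int[OF finite_vector_measure_uminus[OF assms(1)]]
    by (simp add: Jordan_decomposition[OF assms(1) meas] flip: sum_subtractf right_diff_distrib)
qed

text \<open>Both Jordan parts are finite measures, so the constant \<open>C\<close> is an integrable
  majorant for each.\<close>

lemma signed_integral_dominated_convergence:
  assumes "finite_vector_measure M \<nu>"
    and [measurable]: "\<phi> \<in> borel_measurable M" "\<And>k. s k \<in> borel_measurable M"
    and "\<And>x. x \<in> space M \<Longrightarrow> (\<lambda>k. s k x) \<longlonglongrightarrow> \<phi> x"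
    and "\<And>k x. x \<in> space M \<Longrightarrow> \<bar>s k x\<bar> \<le> C"
  shows "(\<lambda>k. signed_integral M \<nu> (s k)) \<longlonglongrightarrow> signed_integral M \<nu> \<phi>"
proof -
  have "(\<lambda>k. \<integral>x. s k x \<partial>positive_part M \<rho>) \<longlonglongrightarrow> (\<integral>x. \<phi> x \<partial>positive_part M \<rho>)"
    if \<rho>: "finite_vector_measure M \<rho>" for \<rho>
  proof -
    interpret finite_measure "positive_part M \<rho>"
      by (rule finite_measure_positive_part[OF \<rho>])
    note [measurable_cong] = sets_positive_part[OF \<rho>]
    show ?thesis
      by (rule integral_dominated_convergence[where w = "\<lambda>_. C"])
        (use assms(4,5) in \<open>auto simp: space_positive_part[OF \<rho>]\<close>)
  qed
  from this[OF assms(1)] this[OF finite_vector_measure_uminus[OF assms(1)]] show ?thesis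
    unfolding signed_integral_def by (rule tendsto_diff)
qed

text \<open>Taking positive parts is not linear, so linearity in the measure cannot be read off the
  definition. It holds for simple functions and passes to bounded measurable functions by dominated
  convergence.\<close>

lemma signed_integral_combination:
  assumes fin: "finite_vector_measure M \<mu>" "finite_vector_measure M \<nu>"
    and eq: "\<And>A. A \<in> sets M \<Longrightarrow> \<rho> A = a * \<mu> A + b * \<nu> A"
    and \<phi>: "\<phi> \<in> borel_measurable M" "\<And>x. x \<in> space M \<Longrightarrow> \<bar>\<phi> x\<bar> \<le> C"
  shows "signed_integral M \<rho> \<phi> = a * signed_integral M \<mu> \<phi> + b * signed_integral M \<nu> \<phi>"
proof -
  have \<rho>: "finite_vector_measure M \<rho>"
    by (rule finite_vector_measure_combination[OF fin, of _ a b]) (simp add: eq)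
  \<comment> \<open>The third property, with 0 as base point, bounds the approximants by twice the
    absolute value of \<open>\<phi>\<close>, whence the majorant \<open>2 * C\<close>.\<close>
  obtain s where s: "\<forall>k. simple_function M (s k)" "\<forall>x\<in>space M. (\<lambda>k. s k x) \<longlonglongrightarrow> \<phi> x"
      "\<forall>k. \<forall>x\<in>space M. dist (s k x) 0 \<le> 2 * dist (\<phi> x) 0"
    using borel_measurable_implies_sequence_metric[OF \<phi>(1), of 0] by auto
  have bound: "\<bar>s k x\<bar> \<le> 2 * C" if "x \<in> space M" for k x
    using s(3)[rule_format, OF that, of k] \<phi>(2)[OF that] by simp
  have lim: "(\<lambda>k. signed_integral M \<kappa> (s k)) \<longlonglongrightarrow> signed_integral M \<kappa> \<phi>"
    if "finite_vector_measure M \<kappa>" for \<kappa>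
    using that \<phi>(1) borel_measurable_simple_function[OF s(1)[rule_format]] s(2)[rule_format] bound
    by (rule signed_integral_dominated_convergence)
  have "signed_integral M \<rho> (s k) = a * signed_integral M \<mu> (s k) + b * signed_integral M \<nu> (s k)"
    for k
  proof -
    have "{x \<in> space M. s k x = y} \<in> sets M" for y
      using simple_functionD(2)[OF s(1)[rule_format], of k "{y}"]
      by (simp add: vimage_def Int_def conj_commute)
    then show ?thesis
      unfolding signed_integral_simple_function[OF \<rho> s(1)[rule_format]] signed_integral_simple_function[OF fin(1) s(1)[rule_format]]
        signed_integral_simple_function[OF fin(2) s(1)[rule_format]]
      by (simp add: eq sum_distrib_left sum.distrib algebra_simps)
  qed
  then have "(\<lambda>k. signed_integral M \<rho> (s k)) \<longlonglongrightarrow>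
      a * signed_integral M \<mu> \<phi> + b * signed_integral M \<nu> \<phi>"
    using lim[OF fin(1)] lim[OF fin(2)] by (auto intro!: tendsto_intros)
  with lim[OF \<rho>] show ?thesis by (rule LIMSEQ_unique)
qed

section \<open>Elementary properties of test functions\<close>

lemma test_functions_mono: "U \<subseteq> V \<Longrightarrow> test_functions U \<subseteq> test_functions V"
  by (auto simp: test_functions_def)

lemma test_function_continuous: "\<phi> \<in> test_functions U \<Longrightarrow> continuous_on UNIV \<phi>"
  by (auto simp: test_functions_def dest: spec[of _ 0])

text \<open>Off the closed support the function vanishes on an open set, and so does its derivative;
  thus supports do not grow. As test functions are bounded, this makes \<open>u\<close> times a
  partial derivative integrable.\<close>

lemma test_function_partial_derivative:
  assumes "\<phi> \<in> test_functions U"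
  shows "partial_derivative i \<phi> \<in> test_functions U"
proof -
  have smooth: "k_times_cont_diff (Suc k) \<phi>" for k
    using assms by (simp add: test_functions_def del: k_times_cont_diff.simps)
  have "{x. partial_derivative i \<phi> x \<noteq> 0} \<subseteq> closure {x. \<phi> x \<noteq> 0}"
  proof
    fix x assume x: "x \<in> {x. partial_derivative i \<phi> x \<noteq> 0}"
    show "x \<in> closure {x. \<phi> x \<noteq> 0}"
    proof (rule ccontr)
      assume "x \<notin> closure {x. \<phi> x \<noteq> 0}"
      then have x': "x \<in> - closure {x. \<phi> x \<noteq> 0}" by simp
      have zero: "0 = \<phi> y" if "y \<in> - closure {x. \<phi> x \<noteq> 0}" for y
        using that closure_subset[of "{x. \<phi> x \<noteq> 0}"] by auto
      have "(\<phi> has_derivative (\<lambda>_. 0)) (at x)"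
        by (rule has_derivative_transform_within_open[OF has_derivative_const
              open_Compl[OF closed_closure] x' zero])
      from partial_derivativeI[OF this, of i] x show False by simp
    qed
  qed
  then have sub: "closure {x. partial_derivative i \<phi> x \<noteq> 0} \<subseteq> closure {x. \<phi> x \<noteq> 0}"
    by (rule closure_minimal) simp
  have "bounded (closure {x. \<phi> x \<noteq> 0})"
    using assms by (simp add: test_functions_def compact_eq_bounded_closed)
  then have "compact (closure {x. partial_derivative i \<phi> x \<noteq> 0})"
    unfolding compact_eq_bounded_closed using bounded_subset[OF _ sub] closed_closure by blast
  moreover have "k_times_cont_diff k (partial_derivative i \<phi>)" for k
    using smooth[of k] by simp
  moreover have "closure {x. \<phi> x \<noteq> 0} \<subseteq> U"
    using assms by (simp add: test_functions_def)
  ultimately show ?thesis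
    unfolding test_functions_def using sub by blast
qed

lemma test_function_bounded:
  assumes "\<phi> \<in> test_functions U"
  obtains C where "\<And>x. \<bar>\<phi> x\<bar> \<le> C"
proof -
  let ?K = "closure {x. \<phi> x \<noteq> 0}"
  have "compact (\<phi> ` ?K)"
    using assms continuous_on_subset[OF test_function_continuous[OF assms]]
    by (intro compact_continuous_image) (auto simp: test_functions_def)
  then obtain C where C: "0 < C" "\<And>y. y \<in> \<phi> ` ?K \<Longrightarrow> \<bar>y\<bar> \<le> C"
    using compact_imp_bounded bounded_pos by (metis real_norm_def)
  have "\<bar>\<phi> x\<bar> \<le> C" for x
  proof (cases "\<phi> x = 0")
    case False
    then show ?thesis using closure_subset[of "{x. \<phi> x \<noteq> 0}"] by (auto intro!: C(2))
  qed (use C in simp)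
  then show thesis by (rule that)
qed

lemma test_function_measurable:
  "\<phi> \<in> test_functions U \<Longrightarrow> \<phi> \<in> borel_measurable (restrict_space borel \<Omega>)"
  by (intro measurable_restrict_space1 borel_measurable_continuous_onI test_function_continuous)

text \<open>The open subsets of \<open>\<Omega>\<close> generate its Borel sets, and their indicators are bounded limits of
  test functions.\<close>

lemma signed_measure_eq_0_of_test_functions:
  fixes \<Omega> :: "(real^'d) set"
  assumes "open \<Omega>" and fin: "finite_radon_measure \<Omega> \<nu>"
    and zero: "\<And>\<phi>. \<phi> \<in> test_functions \<Omega> \<Longrightarrow> signed_integral (restrict_space borel \<Omega>) \<nu> \<phi> = 0"
    and A: "A \<in> sets (restrict_space borel \<Omega>)"
  shows "\<nu> A = 0"
proof -
  let ?M = "restrict_space borel \<Omega>"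
  let ?E = "{U. open U \<and> U \<subseteq> \<Omega>}"
  let ?P = "positive_part ?M \<nu>" and ?N = "positive_part ?M (\<lambda>A. - \<nu> A)"
  note fin' = finite_vector_measure_uminus[OF fin]
  interpret P: finite_measure ?P by (rule finite_measure_positive_part[OF fin])
  interpret N: finite_measure ?N by (rule finite_measure_positive_part[OF fin'])
  have space: "space ?M = \<Omega>" by (simp add: space_restrict_space)
  have sets: "sets ?M = sigma_sets \<Omega> ?E"
  proof -
    have "sets ?M = (\<inter>) \<Omega> ` sigma_sets UNIV {S. open S}"
      by (simp add: sets_restrict_space borel_def)
    also have "\<dots> = sigma_sets \<Omega> ((\<inter>) \<Omega> ` {S. open S})"
      using assms(1) by (intro sigma_sets_Int) auto
    also have "(\<inter>) \<Omega> ` {S. open S} = ?E"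
    proof (intro equalityI subsetI)
      fix U assume "U \<in> ?E"
      then have "U = \<Omega> \<inter> U" "open U" by auto
      then show "U \<in> (\<inter>) \<Omega> ` {S. open S}" by blast
    qed (use assms(1) in auto)
    finally show ?thesis .
  qed
  \<comment> \<open>As \<open>\<nu>\<close> is the difference of its Jordan parts, it vanishes once
    they coincide. They are finite measures, and the open subsets form an intersection-stable
    generator containing \<open>\<Omega>\<close>, so agreement on open subsets suffices.\<close>
  have "?P = ?N"
  proof (rule measure_eqI_generator_eq[where E = ?E and \<Omega> = \<Omega> and A = "\<lambda>_. \<Omega>"])
    show "Int_stable ?E" by (auto simp: Int_stable_def)
    fix U assume U: "U \<in> ?E"
    then have U_sets: "U \<in> sets ?M" unfolding sets by blast
    obtain \<Phi> where \<Phi>: "\<And>k. \<Phi> k \<in> test_functions U" "\<And>k x. 0 \<le> \<Phi> k x" "\<And>k x. \<Phi> k x \<le> 1"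
        "\<And>x. (\<lambda>k. \<Phi> k x) \<longlonglongrightarrow> indicator U x"
      by (rule test_function_indicator_sequence[of U]) (use U in auto)
    have "(\<lambda>k. signed_integral ?M \<nu> (\<Phi> k)) \<longlonglongrightarrow> signed_integral ?M \<nu> (indicator U)"
      by (rule signed_integral_dominated_convergence[OF fin, where C = 1])
        (use U_sets \<Phi> test_function_measurable[OF \<Phi>(1)] in auto)
    moreover have "signed_integral ?M \<nu> (\<Phi> k) = 0" for k
      using test_functions_mono[of U \<Omega>] U \<Phi>(1)[of k] by (intro zero) auto
    ultimately have "signed_integral ?M \<nu> (indicator U) = 0"
      by (simp add: LIMSEQ_const_iff)
    moreover have "U \<inter> \<Omega> = U" using U by auto
    ultimately have "measure ?P U = measure ?N U"
      by (simp add: signed_integral_def space_positive_part[OF fin] space_positive_part[OF fin'] space)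
    then show "emeasure ?P U = emeasure ?N U"
      by (simp add: P.emeasure_eq_measure N.emeasure_eq_measure)
  qed (use assms(1) in \<open>auto simp: sets sets_positive_part[OF fin] sets_positive_part[OF fin']\<close>)
  with Jordan_decomposition[OF fin A] show ?thesis by simp
qed

subsection \<open>Convexity of the energies\<close>

text \<open>Young's inequality with the conjugate exponents \<open>p\<close> and
  \<open>p / (p - 1)\<close> is applied to \<open>x\<close> and \<open>y powr (p - 1)\<close>; the
  second factor contributes \<open>y powr p\<close>.\<close>

lemma powr_tangent_le:
  fixes p x y :: real
  assumes "1 < p" "0 \<le> x" "0 \<le> y"
  shows "y powr p + p * y powr (p - 1) * (x - y) \<le> x powr p"
proof -
  have "x * y powr (p - 1) \<le> x powr p / p + (y powr (p - 1)) powr (p / (p - 1)) / (p / (p - 1))"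
    using assms by (intro Youngs_inequality) (auto simp: field_simps)
  also have "(y powr (p - 1)) powr (p / (p - 1)) = y powr p"
    using assms by (simp add: powr_powr)
  finally have "p * (x * y powr (p - 1)) \<le> x powr p + (p - 1) * y powr p"
    using assms by (simp add: field_simps)
  moreover have "y * y powr (p - 1) = y powr p"
    using assms by (cases "y = 0") (simp_all add: powr_mult_base)
  ultimately show ?thesis by (simp add: algebra_simps)
qed

text \<open>Take the tangent at the intermediate point \<open>z\<close> and average the tangent
  inequalities at \<open>x\<close> and \<open>y\<close>: the linear terms cancel.\<close>

lemma powr_convex_combination:
  fixes p x y t :: real
  assumes "1 < p" "0 \<le> x" "0 \<le> y" "0 \<le> t" "t \<le> 1"
  shows "((1 - t) * x + t * y) powr p \<le> (1 - t) * x powr p + t * y powr p"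
proof -
  define z where "z = (1 - t) * x + t * y"
  have "0 \<le> z" using assms by (simp add: z_def)
  have "(1 - t) * (z powr p + p * z powr (p - 1) * (x - z)) +
      t * (z powr p + p * z powr (p - 1) * (y - z)) \<le> (1 - t) * x powr p + t * y powr p"
    using assms \<open>0 \<le> z\<close> by (intro add_mono mult_left_mono powr_tangent_le) auto
  also have "(1 - t) * (z powr p + p * z powr (p - 1) * (x - z)) +
      t * (z powr p + p * z powr (p - 1) * (y - z)) =
      z powr p + p * z powr (p - 1) * ((1 - t) * x + t * y - z)"
    by (simp add: algebra_simps)
  finally show ?thesis by (simp add: z_def)
qed

lemma norm_convex_combination_powr_le:
  assumes "1 < p" "0 \<le> t" "t \<le> 1"
  shows "norm ((1 - t) *\<^sub>R x + t *\<^sub>R y) powr p \<le> (1 - t) * norm x powr p + t * norm y powr p"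
proof -
  have "norm ((1 - t) *\<^sub>R x + t *\<^sub>R y) \<le> (1 - t) * norm x + t * norm y"
    using norm_triangle_ineq[of "(1 - t) *\<^sub>R x" "t *\<^sub>R y"] assms by simp
  then have "norm ((1 - t) *\<^sub>R x + t *\<^sub>R y) powr p \<le> ((1 - t) * norm x + t * norm y) powr p"
    using assms by (intro powr_mono2) auto
  also have "\<dots> \<le> (1 - t) * norm x powr p + t * norm y powr p"
    using assms by (intro powr_convex_combination) auto
  finally show ?thesis .
qed

section \<open>Lebesgue spaces and Minkowski's inequality\<close>

lemma Lp_convex_combination:
  assumes "1 < p" "0 \<le> t" "t \<le> 1" and g: "g \<in> Lp p \<Omega>" and h: "h \<in> Lp p \<Omega>"
  shows "(\<lambda>x. (1 - t) *\<^sub>R g x + t *\<^sub>R h x) \<in> Lp p \<Omega>"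
proof -
  have [measurable]: "g \<in> borel_measurable (lebesgue_on \<Omega>)" "h \<in> borel_measurable (lebesgue_on \<Omega>)"
    using g h by (auto simp: Lp_def)
  have "integrable (lebesgue_on \<Omega>) (\<lambda>x. norm ((1 - t) *\<^sub>R g x + t *\<^sub>R h x) powr p)"
  proof (rule Bochner_Integration.integrable_bound)
    show "integrable (lebesgue_on \<Omega>) (\<lambda>x. (1 - t) * norm (g x) powr p + t * norm (h x) powr p)"
      using g h by (auto simp: Lp_def)
    show "AE x in lebesgue_on \<Omega>. norm (norm ((1 - t) *\<^sub>R g x + t *\<^sub>R h x) powr p) \<le>
        norm ((1 - t) * norm (g x) powr p + t * norm (h x) powr p)"
      using norm_convex_combination_powr_le[OF assms(1-3)] by (auto intro: order_trans[OF _ abs_ge_self])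
  qed simp
  then show ?thesis by (simp add: Lp_def)
qed

lemma Lp_norm_nonneg: "0 \<le> Lp_norm p \<Omega> g"
  by (simp add: Lp_norm_def)

lemma Lp_norm_powr:
  assumes "1 < p"
  shows "Lp_norm p \<Omega> g powr p = (\<integral>x. norm (g x) powr p \<partial>lebesgue_on \<Omega>)"
  using assms by (simp add: Lp_norm_def powr_powr)

text \<open>Minkowski's inequality: normalise both functions and use that \<open>s \<mapsto> s\<^sup>p\<close> is convex; the
  \<open>\<epsilon>\<close> avoids dividing by a vanishing norm.\<close>

lemma Lp_norm_convex_combination:
  assumes p: "1 < p" and t: "0 \<le> t" "t \<le> 1" and g: "g \<in> Lp p \<Omega>" and h: "h \<in> Lp p \<Omega>"
  shows "Lp_norm p \<Omega> (\<lambda>x. (1 - t) *\<^sub>R g x + t *\<^sub>R h x) \<le> (1 - t) * Lp_norm p \<Omega> g + t * Lp_norm p \<Omega> h"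
proof (rule field_le_epsilon)
  fix \<epsilon> :: real assume "0 < \<epsilon>"
  define a where "a = Lp_norm p \<Omega> g + \<epsilon>"
  define b where "b = Lp_norm p \<Omega> h + \<epsilon>"
  have ab: "0 < a" "0 < b" using \<open>0 < \<epsilon>\<close> by (simp_all add: a_def b_def add_nonneg_pos Lp_norm_nonneg)
  define s where "s = (1 - t) * a + t * b"
  have "0 < s"
    using t ab by (cases "t = 0") (auto simp: s_def intro!: add_nonneg_pos)
  \<comment> \<open>With this weight the combination of \<open>g\<close> and \<open>h\<close> is
    \<open>s\<close> times the convex combination, with weights \<open>1 - l\<close> and
    \<open>l\<close>, of the normalised functions \<open>g / a\<close> and
    \<open>h / b\<close>.\<close>
  define l where "l = t * b / s"
  have l: "0 \<le> l" "l \<le> 1" "s * (1 - l) = (1 - t) * a" "s * l = t * b"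
    using \<open>0 < s\<close> t ab by (auto simp: l_def field_simps s_def)
  have int: "integrable (lebesgue_on \<Omega>) (\<lambda>x. norm (g x) powr p)"
      "integrable (lebesgue_on \<Omega>) (\<lambda>x. norm (h x) powr p)"
    using g h by (auto simp: Lp_def)
  have pointwise: "norm ((1 - t) *\<^sub>R g x + t *\<^sub>R h x) powr p \<le>
      s powr p * ((1 - l) / a powr p * norm (g x) powr p + l / b powr p * norm (h x) powr p)" for x
  proof -
    have "s * ((1 - l) * inverse a) = 1 - t" "s * (l * inverse b) = t"
      using l(3,4) ab by (simp_all flip: mult.assoc)
    then have "(1 - t) *\<^sub>R g x + t *\<^sub>R h x = s *\<^sub>R ((1 - l) *\<^sub>R (g x /\<^sub>R a) + l *\<^sub>R (h x /\<^sub>R b))"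
      by (simp only: scaleR_right_distrib scaleR_scaleR)
    then have "norm ((1 - t) *\<^sub>R g x + t *\<^sub>R h x) powr p =
        s powr p * norm ((1 - l) *\<^sub>R (g x /\<^sub>R a) + l *\<^sub>R (h x /\<^sub>R b)) powr p"
      using \<open>0 < s\<close> by (simp only: norm_scaleR) (simp add: powr_mult)
    also have "\<dots> \<le> s powr p * ((1 - l) * norm (g x /\<^sub>R a) powr p + l * norm (h x /\<^sub>R b) powr p)"
      using p l by (intro mult_left_mono norm_convex_combination_powr_le) auto
    also have "norm (g x /\<^sub>R a) powr p = norm (g x) powr p / a powr p"
      using ab by (simp add: powr_mult inverse_powr divide_inverse mult.commute)
    also have "norm (h x /\<^sub>R b) powr p = norm (h x) powr p / b powr p"
      using ab by (simp add: powr_mult inverse_powr divide_inverse mult.commute)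
    finally show ?thesis by simp
  qed
  have "Lp_norm p \<Omega> (\<lambda>x. (1 - t) *\<^sub>R g x + t *\<^sub>R h x) powr p \<le>
      (\<integral>x. s powr p * ((1 - l) / a powr p * norm (g x) powr p + l / b powr p * norm (h x) powr p)
        \<partial>lebesgue_on \<Omega>)"
    unfolding Lp_norm_powr[OF p]
    using Lp_convex_combination[OF p t g h] int pointwise
    by (intro integral_mono) (auto simp: Lp_def)
  also have "\<dots> = s powr p * ((1 - l) * (Lp_norm p \<Omega> g powr p / a powr p) +
      l * (Lp_norm p \<Omega> h powr p / b powr p))"
    using int by (simp add: Lp_norm_powr[OF p])
  \<comment> \<open>The constants \<open>a\<close> and \<open>b\<close> exceed the norms by
    \<open>\<epsilon>\<close>, so both quotients are at most 1 and the weights sum to 1.\<close>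
  also have "\<dots> \<le> s powr p * ((1 - l) * 1 + l * 1)"
  proof (intro mult_left_mono add_mono)
    show "Lp_norm p \<Omega> g powr p / a powr p \<le> 1" "Lp_norm p \<Omega> h powr p / b powr p \<le> 1"
      using ab p \<open>0 < \<epsilon>\<close> Lp_norm_nonneg[of p \<Omega>]
      by (auto simp: divide_le_eq_1 a_def b_def intro!: powr_mono2)
  qed (use l in auto)
  finally have "Lp_norm p \<Omega> (\<lambda>x. (1 - t) *\<^sub>R g x + t *\<^sub>R h x) powr p \<le> s powr p" by simp
  then have "Lp_norm p \<Omega> (\<lambda>x. (1 - t) *\<^sub>R g x + t *\<^sub>R h x) \<le> s"
    using p \<open>0 < s\<close> powr_less_mono2[of p s] by (metis not_le less_imp_le order_less_trans zero_less_one)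
  also have "s = (1 - t) * Lp_norm p \<Omega> g + t * Lp_norm p \<Omega> h + \<epsilon>"
    by (simp add: s_def a_def b_def algebra_simps)
  finally show "Lp_norm p \<Omega> (\<lambda>x. (1 - t) *\<^sub>R g x + t *\<^sub>R h x) \<le>
      (1 - t) * Lp_norm p \<Omega> g + t * Lp_norm p \<Omega> h + \<epsilon>" .
qed

text \<open>The domain has finite measure and \<open>r \<le> 1 + r powr p\<close>. Integrability is
  what allows the integrals in \<open>density_measure\<close> to be split linearly.\<close>

lemma Lp_integrable:
  assumes "open \<Omega>" "bounded \<Omega>" "1 < p" "w \<in> Lp p \<Omega>"
  shows "integrable (lebesgue_on \<Omega>) w"
proof -
  interpret finite_measure "lebesgue_on \<Omega>"
    using assms(1,2) by (intro finite_measure_lebesgue_on lmeasurable_open)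
  show ?thesis
  proof (rule Bochner_Integration.integrable_bound)
    show "integrable (lebesgue_on \<Omega>) (\<lambda>x. 1 + norm (w x) powr p)"
      using assms(4) by (auto simp: Lp_def)
    have "r \<le> 1 + r powr p" if "0 \<le> r" for r :: real
    proof (cases "r \<le> 1")
      case False
      then have "r powr 1 \<le> r powr p" using assms(3) by (intro powr_mono) auto
      with False show ?thesis by simp
    qed (simp add: add_increasing2)
    then show "AE x in lebesgue_on \<Omega>. norm (w x) \<le> norm (1 + norm (w x) powr p)"
      by (auto intro: order_trans[OF _ abs_ge_self])
  qed (use assms(4) in \<open>auto simp: Lp_def\<close>)
qed

section \<open>Linearity of density measures and of distributional derivatives\<close>

lemma density_measure_combination:
  assumes "integrable (lebesgue_on \<Omega>) v" "integrable (lebesgue_on \<Omega>) w"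
    and "\<Omega> \<in> sets borel" "A \<in> sets (restrict_space borel \<Omega>)"
  shows "density_measure \<Omega> (\<lambda>x. a *\<^sub>R v x + b *\<^sub>R w x) A =
    a *\<^sub>R density_measure \<Omega> v A + b *\<^sub>R density_measure \<Omega> w A"
proof -
  have "A \<subseteq> \<Omega>" "A \<in> sets borel"
    using assms(3,4) by (auto simp: sets_restrict_space_iff)
  then have "A \<in> sets (lebesgue_on \<Omega>)"
    using assms(3) by (simp add: sets_restrict_space_iff)
  then have "integrable (lebesgue_on \<Omega>) (\<lambda>x. indicator A x *\<^sub>R v x)"
      "integrable (lebesgue_on \<Omega>) (\<lambda>x. indicator A x *\<^sub>R w x)"
    using assms(1,2) by (auto intro: integrable_mult_indicator)
  moreover have "indicator A x *\<^sub>R (a *\<^sub>R v x + b *\<^sub>R w x) =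
      a *\<^sub>R (indicator A x *\<^sub>R v x) + b *\<^sub>R (indicator A x *\<^sub>R w x)" for x
    by (simp add: scaleR_right_distrib mult.commute)
  ultimately show ?thesis
    unfolding density_measure_def by (simp del: scaleR_scaleR)
qed

text \<open>Each component of the difference is a finite signed measure that annihilates all test
  functions.\<close>

lemma distributional_derivative_unique:
  assumes "open \<Omega>" and fin: "finite_radon_measure \<Omega> \<mu>" "finite_radon_measure \<Omega> \<nu>"
    and der: "is_distributional_derivative \<Omega> u \<mu>" "is_distributional_derivative \<Omega> u \<nu>"
    and A: "A \<in> sets (restrict_space borel \<Omega>)"
  shows "\<mu> A = \<nu> A"
proof (rule vec_eq_iff[THEN iffD2], rule allI)
  fix i
  let ?M = "restrict_space borel \<Omega>"
  let ?\<rho> = "\<lambda>A. \<mu> A $ i - \<nu> A $ i"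
  note fin_i = fin[THEN finite_vector_measure_component, of i]
  have "?\<rho> A = 0"
  proof (rule signed_measure_eq_0_of_test_functions[OF assms(1) _ _ A])
    show "finite_radon_measure \<Omega> ?\<rho>"
      by (rule finite_vector_measure_combination[OF fin_i, where a = 1 and b = "-1"]) simp
    fix \<phi> assume \<phi>: "\<phi> \<in> test_functions \<Omega>"
    obtain C where "\<And>x. \<bar>\<phi> x\<bar> \<le> C" using test_function_bounded[OF \<phi>] by blast
    then have "signed_integral ?M ?\<rho> \<phi> =
        1 * signed_integral ?M (\<lambda>A. \<mu> A $ i) \<phi> + (- 1) * signed_integral ?M (\<lambda>A. \<nu> A $ i) \<phi>"
      using test_function_measurable[OF \<phi>]
      by (intro signed_integral_combination[OF fin_i]) auto
    then show "signed_integral ?M ?\<rho> \<phi> = 0"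
      using der \<phi> unfolding is_distributional_derivative_def by force
  qed
  then show "\<mu> A $ i = \<nu> A $ i" by simp
qed

lemma BV_distributional_derivative:
  assumes "u \<in> BV \<Omega>"
  shows "finite_radon_measure \<Omega> (distributional_derivative \<Omega> u)"
    and "is_distributional_derivative \<Omega> u (distributional_derivative \<Omega> u)"
proof -
  have "\<exists>\<mu>. finite_radon_measure \<Omega> \<mu> \<and> is_distributional_derivative \<Omega> u \<mu>"
    using assms by (simp add: BV_def)
  from someI_ex[OF this]
  show "finite_radon_measure \<Omega> (distributional_derivative \<Omega> u)"
    "is_distributional_derivative \<Omega> u (distributional_derivative \<Omega> u)"
    by (simp_all add: distributional_derivative_def)
qed

lemma integrable_mult_test_function:
  assumes "open \<Omega>" "integrable (lebesgue_on \<Omega>) u" "\<phi> \<in> test_functions U"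
  shows "integrable (lebesgue_on \<Omega>) (\<lambda>x. u x * \<phi> x)"
proof -
  obtain C where C: "\<And>x. \<bar>\<phi> x\<bar> \<le> C" using test_function_bounded[OF assms(3)] by blast
  have [measurable]: "\<phi> \<in> borel_measurable (lebesgue_on \<Omega>)"
    using assms(1) continuous_on_subset[OF test_function_continuous[OF assms(3)]]
    by (intro continuous_imp_measurable_on_sets_lebesgue) auto
  have [measurable]: "u \<in> borel_measurable (lebesgue_on \<Omega>)"
    using assms(2) by (rule borel_measurable_integrable)
  show ?thesis
  proof (rule Bochner_Integration.integrable_bound)
    show "integrable (lebesgue_on \<Omega>) (\<lambda>x. C * u x)" using assms(2) by simp
    have "\<bar>u x * \<phi> x\<bar> \<le> \<bar>C * u x\<bar>" for x
      using mult_left_mono[OF order_trans[OF C abs_ge_self], of "\<bar>u x\<bar>" x] by (simp add: abs_mult mult.commute)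
    then show "AE x in lebesgue_on \<Omega>. norm (u x * \<phi> x) \<le> norm (C * u x)" by simp
  qed simp
qed

lemma is_distributional_derivative_combination:
  assumes "open \<Omega>" and int: "integrable (lebesgue_on \<Omega>) u" "integrable (lebesgue_on \<Omega>) v"
    and fin: "finite_radon_measure \<Omega> \<mu>" "finite_radon_measure \<Omega> \<nu>"
    and der: "is_distributional_derivative \<Omega> u \<mu>" "is_distributional_derivative \<Omega> v \<nu>"
  shows "is_distributional_derivative \<Omega> (\<lambda>x. a * u x + b * v x) (\<lambda>A. a *\<^sub>R \<mu> A + b *\<^sub>R \<nu> A)"
  unfolding is_distributional_derivative_def
proof (intro ballI allI)
  fix \<phi> i assume \<phi>: "\<phi> \<in> test_functions \<Omega>"
  let ?M = "restrict_space borel \<Omega>"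
  note int_d = int[THEN integrable_mult_test_function[OF assms(1)],
      OF test_function_partial_derivative[OF \<phi>, of i]]
  note fin_i = fin[THEN finite_vector_measure_component, of i]
  obtain C where "\<And>x. \<bar>\<phi> x\<bar> \<le> C" using test_function_bounded[OF \<phi>] by blast
  then have signed: "signed_integral ?M (\<lambda>A. (a *\<^sub>R \<mu> A + b *\<^sub>R \<nu> A) $ i) \<phi> =
      a * signed_integral ?M (\<lambda>A. \<mu> A $ i) \<phi> + b * signed_integral ?M (\<lambda>A. \<nu> A $ i) \<phi>"
    using test_function_measurable[OF \<phi>]
    by (intro signed_integral_combination[OF fin_i]) auto
  have "(\<integral>x. (a * u x + b * v x) * partial_derivative i \<phi> x \<partial>lebesgue_on \<Omega>) =
      (\<integral>x. a * (u x * partial_derivative i \<phi> x) + b * (v x * partial_derivative i \<phi> x) \<partial>lebesgue_on \<Omega>)"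
    by (simp add: algebra_simps)
  also have "\<dots> = a * (\<integral>x. u x * partial_derivative i \<phi> x \<partial>lebesgue_on \<Omega>) +
      b * (\<integral>x. v x * partial_derivative i \<phi> x \<partial>lebesgue_on \<Omega>)"
    using int_d by simp
  also have "\<dots> = - signed_integral ?M (\<lambda>A. (a *\<^sub>R \<mu> A + b *\<^sub>R \<nu> A) $ i) \<phi>"
    using der \<phi> unfolding signed is_distributional_derivative_def by simp
  finally show "(\<integral>x. (a * u x + b * v x) * partial_derivative i \<phi> x \<partial>lebesgue_on \<Omega>) =
      - signed_integral ?M (\<lambda>A. (a *\<^sub>R \<mu> A + b *\<^sub>R \<nu> A) $ i) \<phi>" .
qed

text \<open>The combination of the two chosen measures represents the derivative of the combined
  function but need not be the measure chosen for it; uniqueness makes the two agree on Borel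
  subsets of \<open>\<Omega>\<close>.\<close>

lemma
  assumes "open \<Omega>" and u: "u \<in> BV \<Omega>" and v: "v \<in> BV \<Omega>"
  shows BV_combination: "(\<lambda>x. a * u x + b * v x) \<in> BV \<Omega>"
    and distributional_derivative_combination:
      "A \<in> sets (restrict_space borel \<Omega>) \<Longrightarrow>
        distributional_derivative \<Omega> (\<lambda>x. a * u x + b * v x) A =
        a *\<^sub>R distributional_derivative \<Omega> u A + b *\<^sub>R distributional_derivative \<Omega> v A"
proof -
  let ?\<mu> = "\<lambda>A. a *\<^sub>R distributional_derivative \<Omega> u A + b *\<^sub>R distributional_derivative \<Omega> v A"
  have int: "integrable (lebesgue_on \<Omega>) u" "integrable (lebesgue_on \<Omega>) v"
    using u v by (auto simp: BV_def)
  note Du = BV_distributional_derivative[OF u] and Dv = BV_distributional_derivative[OF v]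
  have fin: "finite_radon_measure \<Omega> ?\<mu>"
    by (rule finite_vector_measure_combination[OF Du(1) Dv(1)]) simp
  have der: "is_distributional_derivative \<Omega> (\<lambda>x. a * u x + b * v x) ?\<mu>"
    by (rule is_distributional_derivative_combination[OF assms(1) int Du(1) Dv(1) Du(2) Dv(2)])
  show BV: "(\<lambda>x. a * u x + b * v x) \<in> BV \<Omega>"
    using int fin der by (auto simp: BV_def)
  show "distributional_derivative \<Omega> (\<lambda>x. a * u x + b * v x) A = ?\<mu> A"
    if "A \<in> sets (restrict_space borel \<Omega>)"
    by (rule distributional_derivative_unique[OF assms(1) BV_distributional_derivative(1)[OF BV] fin
          BV_distributional_derivative(2)[OF BV] der that])
qed

text \<open>The square is convex under the integral, and \<open>Du - w\<close> depends linearly on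
  the pair, so the variation bound applies. Working in \<open>ennreal\<close> includes functions
  outside the space of square-integrable ones, where the fidelity term is infinite.\<close>

lemma fidelity_and_TV_convex_combination:
  assumes "open \<Omega>" and t: "0 \<le> t" "t \<le> 1" and "0 \<le> \<alpha>"
    and f: "f \<in> borel_measurable (lebesgue_on \<Omega>)"
    and w: "integrable (lebesgue_on \<Omega>) w" "integrable (lebesgue_on \<Omega>) w'"
    and u: "u \<in> BV \<Omega>" "u' \<in> BV \<Omega>"
  shows "fidelity_and_TV \<Omega> \<alpha> f (\<lambda>x. (1 - t) *\<^sub>R w x + t *\<^sub>R w' x) (\<lambda>x. (1 - t) * u x + t * u' x) \<le>
    ennreal (1 - t) * fidelity_and_TV \<Omega> \<alpha> f w u + ennreal t * fidelity_and_TV \<Omega> \<alpha> f w' u'"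
proof -
  have [measurable]: "f \<in> borel_measurable (lebesgue_on \<Omega>)" "u \<in> borel_measurable (lebesgue_on \<Omega>)"
      "u' \<in> borel_measurable (lebesgue_on \<Omega>)"
    using f u by (auto simp: BV_def)
  let ?fid = "\<lambda>u. \<integral>\<^sup>+x. ennreal ((f x - u x)\<^sup>2) \<partial>lebesgue_on \<Omega>"
  let ?TV = "\<lambda>w u. radon_norm \<Omega> (\<lambda>A. distributional_derivative \<Omega> u A - density_measure \<Omega> w A)"
  have sq: "((1 - t) * a + t * b)\<^sup>2 \<le> (1 - t) * a\<^sup>2 + t * b\<^sup>2" for a b :: real
  proof -
    have "(1 - t) * a\<^sup>2 + t * b\<^sup>2 - ((1 - t) * a + t * b)\<^sup>2 = t * (1 - t) * (a - b)\<^sup>2"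
      by (simp add: power2_eq_square algebra_simps)
    moreover have "0 \<le> t * (1 - t) * (a - b)\<^sup>2" using t by simp
    ultimately show ?thesis by linarith
  qed
  have "?fid (\<lambda>x. (1 - t) * u x + t * u' x) \<le>
      (\<integral>\<^sup>+x. ennreal (1 - t) * ennreal ((f x - u x)\<^sup>2) + ennreal t * ennreal ((f x - u' x)\<^sup>2)
        \<partial>lebesgue_on \<Omega>)"
  proof (rule nn_integral_mono)
    fix x
    have "f x - ((1 - t) * u x + t * u' x) = (1 - t) * (f x - u x) + t * (f x - u' x)"
      by (simp add: algebra_simps)
    then have "(f x - ((1 - t) * u x + t * u' x))\<^sup>2 \<le> (1 - t) * (f x - u x)\<^sup>2 + t * (f x - u' x)\<^sup>2"
      using sq by simp
    then show "ennreal ((f x - ((1 - t) * u x + t * u' x))\<^sup>2) \<le>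
        ennreal (1 - t) * ennreal ((f x - u x)\<^sup>2) + ennreal t * ennreal ((f x - u' x)\<^sup>2)"
      using t by (simp add: ennreal_leI flip: ennreal_mult ennreal_plus)
  qed
  also have "\<dots> = ennreal (1 - t) * ?fid u + ennreal t * ?fid u'"
    by (simp add: nn_integral_add nn_integral_cmult)
  finally have fid: "?fid (\<lambda>x. (1 - t) * u x + t * u' x) \<le> ennreal (1 - t) * ?fid u + ennreal t * ?fid u'" .
  have TV: "?TV (\<lambda>x. (1 - t) *\<^sub>R w x + t *\<^sub>R w' x) (\<lambda>x. (1 - t) * u x + t * u' x) \<le>
      ennreal (1 - t) * ?TV w u + ennreal t * ?TV w' u'"
    unfolding radon_norm_def
  proof (rule variation_le_combination)
    fix A assume A: "A \<in> sets (restrict_space borel \<Omega>)"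
    let ?x = "distributional_derivative \<Omega> u A - density_measure \<Omega> w A"
    let ?y = "distributional_derivative \<Omega> u' A - density_measure \<Omega> w' A"
    have "distributional_derivative \<Omega> (\<lambda>x. (1 - t) * u x + t * u' x) A -
        density_measure \<Omega> (\<lambda>x. (1 - t) *\<^sub>R w x + t *\<^sub>R w' x) A = (1 - t) *\<^sub>R ?x + t *\<^sub>R ?y"
      unfolding distributional_derivative_combination[OF assms(1) u A]
        density_measure_combination[OF w borel_open[OF assms(1)] A]
      by (simp add: algebra_simps)
    then show "norm (distributional_derivative \<Omega> (\<lambda>x. (1 - t) * u x + t * u' x) A -
        density_measure \<Omega> (\<lambda>x. (1 - t) *\<^sub>R w x + t *\<^sub>R w' x) A) \<le> (1 - t) * norm ?x + t * norm ?y"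
      using norm_triangle_ineq[of "(1 - t) *\<^sub>R ?x" "t *\<^sub>R ?y"] t by simp
  qed (use t in auto)
  have "fidelity_and_TV \<Omega> \<alpha> f (\<lambda>x. (1 - t) *\<^sub>R w x + t *\<^sub>R w' x) (\<lambda>x. (1 - t) * u x + t * u' x) \<le>
      ennreal (1 / 2) * (ennreal (1 - t) * ?fid u + ennreal t * ?fid u') +
      ennreal \<alpha> * (ennreal (1 - t) * ?TV w u + ennreal t * ?TV w' u')"
    unfolding fidelity_and_TV_def by (intro add_mono mult_left_mono fid TV) simp_all
  also have "\<dots> = ennreal (1 - t) * fidelity_and_TV \<Omega> \<alpha> f w u + ennreal t * fidelity_and_TV \<Omega> \<alpha> f w' u'"
    unfolding fidelity_and_TV_def by (simp add: distrib_left mult.left_commute add_ac)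
  finally show ?thesis .
qed

section \<open>Equivalence of the two minimisation problems\<close>

theorem proposition3p2:
  fixes \<Omega> :: "(real^'d) set"
    and p \<alpha> \<beta>p \<beta>1 :: real
    and f us :: "real^'d \<Rightarrow> real"
    and ws :: "real^'d \<Rightarrow> real^'d"
  assumes "bounded_lipschitz_domain \<Omega>"
    and "1 < p" and "0 < \<alpha>" and "0 < \<beta>p"
    and "f \<in> Lp 2 \<Omega>"
    and "\<not> (\<exists>c. AE x in lebesgue_on \<Omega>. f x = c)"
    and "ws \<in> Lp p \<Omega>" and "us \<in> BV \<Omega>"
    and "\<beta>1 = \<beta>p * Lp_norm p \<Omega> ws powr (p - 1)"
  shows "is_arg_min (p_homogeneous_energy \<Omega> p \<alpha> \<beta>p f) (\<lambda>z. z \<in> Lp p \<Omega> \<times> BV \<Omega>) (ws, us) \<longleftrightarrow>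
         is_arg_min (one_homogeneous_energy \<Omega> p \<alpha> \<beta>1 f) (\<lambda>z. z \<in> Lp p \<Omega> \<times> BV \<Omega>) (ws, us)"
proof -
  have \<Omega>: "open \<Omega>" "bounded \<Omega>" using assms(1) by (auto simp: bounded_lipschitz_domain_def)
  note p = assms(2)
  define a where "a = Lp_norm p \<Omega> ws"
  have "0 \<le> a" by (simp add: a_def Lp_norm_nonneg)
  have "0 \<le> \<beta>1" and \<beta>1: "\<beta>1 = \<beta>p * a powr (p - 1)" using assms(4,9) by (simp_all add: a_def)
  let ?F = "fidelity_and_TV \<Omega> \<alpha> f"
  have adm: "(ws, us) \<in> Lp p \<Omega> \<times> BV \<Omega>" using assms(7,8) by simp
  \<comment> \<open>The slope \<open>\<beta>p * y powr (p - 1)\<close> becomes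
    \<open>\<beta>1\<close> at \<open>y = a\<close>.\<close>
  have tangent: "\<beta>p / p * y powr p + \<beta>p * y powr (p - 1) * (x - y) \<le> \<beta>p / p * x powr p"
    if "0 \<le> x" "0 \<le> y" for x y
    using mult_left_mono[OF powr_tangent_le[OF p that], of "\<beta>p / p"] assms(4) p
    by (simp add: algebra_simps)
  have "?F ws us + ennreal (\<beta>1 * a) \<le> ?F w u + ennreal (\<beta>1 * Lp_norm p \<Omega> w)"
    if min: "\<And>w u. w \<in> Lp p \<Omega> \<Longrightarrow> u \<in> BV \<Omega> \<Longrightarrow>
        ?F ws us + ennreal (\<beta>p / p * a powr p) \<le> ?F w u + ennreal (\<beta>p / p * Lp_norm p \<Omega> w powr p)"
      and w: "w \<in> Lp p \<Omega>" and u: "u \<in> BV \<Omega>" for w u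
  proof (cases "?F w u = \<infinity>")
    case False
    define b where "b = Lp_norm p \<Omega> w"
    have "0 \<le> b" by (simp add: b_def Lp_norm_nonneg)
    obtain F where F: "?F w u = ennreal F" "0 \<le> F" using False by (cases "?F w u") auto
    \<comment> \<open>A competitor of finite energy forces the minimiser to have finite energy, so
      the comparison can continue in real numbers.\<close>
    have "?F ws us + ennreal (\<beta>p / p * a powr p) < \<infinity>"
      using min[OF w u] False by (auto simp: less_top[symmetric] top_unique)
    then obtain Fs where Fs: "?F ws us = ennreal Fs" "0 \<le> Fs" by (cases "?F ws us") auto
    \<comment> \<open>The increment of the penalty from \<open>a\<close> to
      \<open>c = a + t * (b - a)\<close> is bounded using the tangent at \<open>c\<close>, not at
      \<open>a\<close>. The bound is exactly \<open>t\<close> times the slope at \<open>c\<close>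
      times \<open>b - a\<close>, so after cancelling \<open>t\<close> only continuity of the slope
      is needed in the limit.\<close>
    have slope: "Fs - F \<le> \<beta>p * (a + t * (b - a)) powr (p - 1) * (b - a)" if t: "0 < t" "t < 1" for t
    proof -
      let ?w = "\<lambda>x. (1 - t) *\<^sub>R ws x + t *\<^sub>R w x" and ?u = "\<lambda>x. (1 - t) * us x + t * u x"
      let ?n = "Lp_norm p \<Omega> ?w"
      define c where "c = a + t * (b - a)"
      have c: "c = (1 - t) * a + t * b" by (simp add: c_def algebra_simps)
      then have "0 \<le> c" using t \<open>0 \<le> a\<close> \<open>0 \<le> b\<close> by simp
      have "?n \<le> c"
        unfolding c a_def b_def
        using Lp_norm_convex_combination[OF p _ _ assms(7) w, of t] t by simp
      then have n: "\<beta>p / p * ?n powr p \<le> \<beta>p / p * c powr p"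
        using p assms(4) by (intro mult_left_mono powr_mono2) (auto simp: Lp_norm_nonneg)
      have "ennreal (Fs + \<beta>p / p * a powr p) = ?F ws us + ennreal (\<beta>p / p * a powr p)"
        using Fs p assms(4) by (simp add: ennreal_plus)
      also have "\<dots> \<le> ?F ?w ?u + ennreal (\<beta>p / p * ?n powr p)"
        using t by (intro min Lp_convex_combination p assms(7) w BV_combination \<Omega> assms(8) u) auto
      also have "\<dots> \<le> (ennreal (1 - t) * ?F ws us + ennreal t * ?F w u) + ennreal (\<beta>p / p * c powr p)"
        using t assms(3,5) n Lp_integrable[OF \<Omega> p] assms(7) w
        by (intro add_mono fidelity_and_TV_convex_combination \<Omega> assms(8) u ennreal_leI)
          (auto simp: Lp_def)
      also have "\<dots> = ennreal ((1 - t) * Fs + t * F + \<beta>p / p * c powr p)"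
        using t Fs F p assms(4) by (simp add: ennreal_plus ennreal_mult)
      finally have "Fs + \<beta>p / p * a powr p \<le> (1 - t) * Fs + t * F + \<beta>p / p * c powr p"
        using t Fs F p assms(4) by (subst (asm) ennreal_le_iff) auto
      with tangent[OF \<open>0 \<le> a\<close> \<open>0 \<le> c\<close>]
      have "t * (Fs - F) \<le> t * (\<beta>p * c powr (p - 1) * (b - a))"
        by (simp add: c_def algebra_simps)
      with t show ?thesis by (simp add: c_def)
    qed
    have "((\<lambda>t. \<beta>p * (a + t * (b - a)) powr (p - 1) * (b - a)) \<longlongrightarrow> \<beta>1 * (b - a)) (at_right 0)"
    proof -
      have "((\<lambda>t. (a + t * (b - a)) powr (p - 1)) \<longlongrightarrow> (a + 0 * (b - a)) powr (p - 1)) (at_right 0)"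
      \<comment> \<open>The case \<open>a = 0\<close> is included: there continuity of the power
        rests on the positive exponent \<open>p - 1\<close> and on bases that stay nonnegative for
        small \<open>t\<close>.\<close>
      proof (rule tendsto_powr')
        have "0 \<le> a + t * (b - a)" if "0 < t" "t < 1" for t
        proof -
          have "a + t * (b - a) = (1 - t) * a + t * b" by (simp add: algebra_simps)
          then show ?thesis using that \<open>0 \<le> a\<close> \<open>0 \<le> b\<close> by simp
        qed
        then have "\<forall>\<^sub>F t in at_right 0. 0 \<le> a + t * (b - a)"
          by (intro eventually_at_rightI[of 0 1]) auto
        then show "a + 0 * (b - a) \<noteq> 0 \<or> 0 < p - 1 \<and> (\<forall>\<^sub>F t in at_right 0. 0 \<le> a + t * (b - a))"
          using p by simp
      qed (intro tendsto_intros)+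
      from tendsto_mult_right[OF tendsto_mult_left[OF this, of \<beta>p], of "b - a"]
      show ?thesis by (simp add: \<beta>1)
    qed
    then have "Fs - F \<le> \<beta>1 * (b - a)"
      by (rule tendsto_lowerbound) (auto intro!: eventually_at_rightI[of 0 1] slope)
    then have "Fs + \<beta>1 * a \<le> F + \<beta>1 * b" by (simp add: algebra_simps)
    then show ?thesis
      using F Fs \<open>0 \<le> \<beta>1\<close> \<open>0 \<le> a\<close> \<open>0 \<le> b\<close>
      by (simp add: ennreal_leI flip: ennreal_plus b_def)
  qed simp
  \<comment> \<open>Here each competitor is compared with the minimiser directly, without convex
    combinations: the tangent at \<open>a\<close>, evaluated at \<open>b\<close>, turns one
    inequality into the other.\<close>
  moreover have "?F ws us + ennreal (\<beta>p / p * a powr p) \<le> ?F w u + ennreal (\<beta>p / p * Lp_norm p \<Omega> w powr p)"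
    if min: "?F ws us + ennreal (\<beta>1 * a) \<le> ?F w u + ennreal (\<beta>1 * Lp_norm p \<Omega> w)" for w u
  proof (cases "?F w u = \<infinity>")
    case False
    define b where "b = Lp_norm p \<Omega> w"
    have "0 \<le> b" by (simp add: b_def Lp_norm_nonneg)
    obtain F where F: "?F w u = ennreal F" "0 \<le> F" using False by (cases "?F w u") auto
    have "?F ws us + ennreal (\<beta>1 * a) < \<infinity>"
      using min False by (auto simp: less_top[symmetric] top_unique)
    then obtain Fs where Fs: "?F ws us = ennreal Fs" "0 \<le> Fs" by (cases "?F ws us") auto
    have "Fs + \<beta>1 * a \<le> F + \<beta>1 * b"
      using min F Fs \<open>0 \<le> \<beta>1\<close> \<open>0 \<le> a\<close> \<open>0 \<le> b\<close>
      by (simp add: ennreal_le_iff flip: ennreal_plus b_def)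
    with tangent[OF \<open>0 \<le> b\<close> \<open>0 \<le> a\<close>]
    have "Fs + \<beta>p / p * a powr p \<le> F + \<beta>p / p * b powr p"
      by (simp add: \<beta>1 algebra_simps)
    then show ?thesis
      using F Fs p assms(4)
      by (simp add: ennreal_leI flip: ennreal_plus b_def)
  qed simp
  ultimately show ?thesis
    using adm unfolding is_arg_min_linorder p_homogeneous_energy_def one_homogeneous_energy_def
    by (auto simp: a_def)
qed

end
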